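(* Let $m,n,r,s$ be nonzero integers with $(r,s)\neq(\pm1,\pm1)$ (that is, $|r|$ and $|s|$ are not both equal to $1$). Then $BS(r,s)$ embeds into $BS(m,n)$ (i.e. is isomorphic to a subgroup of it) if and only if the following three conditions hold: \begin{enumerate} \item $\frac rs$ is a power of $\frac mn$ (with exponent in $\mathbb{Z}$); \item for every prime $p$ and every integer $\alpha\ge0$: if $m$ and $n$ are both divisible by $p^\alpha$ but neither is divisible by $p^{\alpha+1}$, then neither $r$ nor $s$ is divisible by $p^{\alpha+1}$ (in particular, taking $\alpha=0$, any prime dividing $rs$ divides $mn$); \item if $m$ or $n$ equals $\pm1$, then $r$ or $s$ equals $\pm1$. \end{enumerate}
   Context: For nonzero integers $m,n$, $BS(m,n)=\langle a,t\mid ta^mt^{-1}=a^n\rangle$. *)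

theory Defs
  imports Complex_Main "HOL-Algebra.Group" "HOL-Computational_Algebra.Primes"
begin

text \<open>
  Group presentations. A letter \<open>(x, True)\<close> is the generator \<open>x\<close>, and \<open>(x, False)\<close> is its
  formal inverse. Every element of the type \<open>'g\<close> is a generator; a pair \<open>(l, r)\<close> of words in
  \<open>R\<close> is the defining relation \<open>l = r\<close>.
\<close>

type_synonym 'g word = "('g \<times> bool) list"

inductive word_step :: "('g word \<times> 'g word) set \<Rightarrow> 'g word \<Rightarrow> 'g word \<Rightarrow> bool" for R where
  cancel: "word_step R (u @ [(x, b), (x, \<not> b)] @ v) (u @ v)"
| relation: "(l, r) \<in> R \<Longrightarrow> word_step R (u @ l @ v) (u @ r @ v)"

definition word_rel :: "('g word \<times> 'g word) set \<Rightarrow> ('g word \<times> 'g word) set" where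
  "word_rel R = {(u, v). equivclp (word_step R) u v}"

definition presented_group :: "('g word \<times> 'g word) set \<Rightarrow> 'g word set monoid" where
  "presented_group R =
    \<lparr>carrier = UNIV // word_rel R,
     monoid.mult = (\<lambda>U V. word_rel R `` {u @ v |u v. u \<in> U \<and> v \<in> V}),
     one = word_rel R `` {[]}\<rparr>"

definition word_pow :: "'g \<Rightarrow> int \<Rightarrow> 'g word" where
  "word_pow x k = replicate (nat \<bar>k\<bar>) (x, 0 \<le> k)"

datatype bs_gen = a | t

definition BS :: "int \<Rightarrow> int \<Rightarrow> bs_gen word set monoid" where
  "BS m n = presented_group
     {(word_pow t 1 @ word_pow a m @ word_pow t (-1), word_pow a n)}"

hide_const (open) a t

definition embeds_in :: "('a, 'c) monoid_scheme \<Rightarrow> ('b, 'd) monoid_scheme \<Rightarrow> bool" where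
  "embeds_in G K \<longleftrightarrow> (\<exists>H. subgroup H K \<and> G \<cong> K\<lparr>carrier := H\<rparr>)"


lemma equiv_word_rel: "equiv UNIV (word_rel R)"
  unfolding word_rel_def equiv_def refl_on_def sym_def trans_def
  by (auto intro: equivclp_sym equivclp_trans)

lemma word_step_append: "word_step R u v \<Longrightarrow> word_step R (p @ u @ q) (p @ v @ q)"
proof (induction rule: word_step.induct)
  case (cancel u x b v)
  show ?case using word_step.cancel[of R "p @ u" x b "v @ q"] by simp
next
  case (relation l r u v)
  then show ?case using word_step.relation[of l r R "p @ u" "v @ q"] by simp
qed

lemma word_rel_context: "(u, v) \<in> word_rel R \<Longrightarrow> (p @ u @ q, p @ v @ q) \<in> word_rel R"
  unfolding word_rel_def mem_Collect_eq prod.case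
proof (induction rule: equivclp_induct)
  case base
  show ?case by simp
next
  case (step y z)
  have "equivclp (word_step R) (p @ y @ q) (p @ z @ q)"
    using step.hyps(2) word_step_append[of R] by (metis r_into_equivclp equivclp_sym)
  then show ?case using step.IH equivclp_trans by metis
qed

lemma word_rel_append:
  assumes "(u, u') \<in> word_rel R" "(v, v') \<in> word_rel R"
  shows "(u @ v, u' @ v') \<in> word_rel R"
  using word_rel_context[OF assms(1), of "[]" v] word_rel_context[OF assms(2), of u' "[]"]
    equiv_word_rel[of R] by (auto simp: equiv_def dest: transD)

lemma word_rel_step: "word_step R u v \<Longrightarrow> (u, v) \<in> word_rel R"
  by (simp add: word_rel_def r_into_equivclp)

lemma word_class_eq_iff:
  "word_rel R `` {u} = word_rel R `` {v} \<longleftrightarrow> (u, v) \<in> word_rel R"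
  using eq_equiv_class_iff[OF equiv_word_rel[of R], of u v] by simp

lemma carrier_presented_group:
  "carrier (presented_group R) = range (\<lambda>w. word_rel R `` {w})"
  by (auto simp: presented_group_def quotient_def)

lemma one_presented_group: "\<one>\<^bsub>presented_group R\<^esub> = word_rel R `` {[]}"
  by (simp add: presented_group_def)

lemma mult_presented_group:
  "(word_rel R `` {u}) \<otimes>\<^bsub>presented_group R\<^esub> (word_rel R `` {v}) = word_rel R `` {u @ v}"
proof -
  have "(w \<in> word_rel R `` {x @ y |x y. x \<in> word_rel R `` {u} \<and> y \<in> word_rel R `` {v}})
      \<longleftrightarrow> (u @ v, w) \<in> word_rel R" for w
  proof
    assume "w \<in> word_rel R `` {x @ y |x y. x \<in> word_rel R `` {u} \<and> y \<in> word_rel R `` {v}}"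
    then obtain x y where "(u, x) \<in> word_rel R" "(v, y) \<in> word_rel R" "(x @ y, w) \<in> word_rel R"
      by auto
    then show "(u @ v, w) \<in> word_rel R"
      using word_rel_append equiv_word_rel[of R] by (metis equivE transD)
  next
    assume "(u @ v, w) \<in> word_rel R"
    moreover have "(u, u) \<in> word_rel R" "(v, v) \<in> word_rel R"
      using equiv_word_rel[of R] by (simp_all add: equiv_def refl_on_def)
    ultimately show "w \<in> word_rel R `` {x @ y |x y. x \<in> word_rel R `` {u} \<and> y \<in> word_rel R `` {v}}"
      by blast
  qed
  then show ?thesis by (auto simp: presented_group_def)
qed

lemma word_inverse:
  "\<exists>v. (v @ u, []) \<in> word_rel R"
proof (induction u)
  case Nil
  show ?case using equiv_word_rel[of R] by (auto simp: equiv_def refl_on_def)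
next
  case (Cons c u)
  obtain x b where c: "c = (x, b)" by fastforce
  from Cons obtain v where v: "(v @ u, []) \<in> word_rel R" by blast
  have "((v @ [(x, \<not> b)]) @ c # u, v @ u) \<in> word_rel R"
    using word_rel_step[OF word_step.cancel[of R v x "\<not> b" u]] c by simp
  then show ?case using v equiv_word_rel[of R] by (metis equivE transD)
qed

lemma group_presented_group: "group (presented_group R)"
proof (rule groupI)
  show "\<exists>y\<in>carrier (presented_group R). y \<otimes>\<^bsub>presented_group R\<^esub> x = \<one>\<^bsub>presented_group R\<^esub>"
    if "x \<in> carrier (presented_group R)" for x
    using that word_inverse[of _ R]
    by (fastforce simp: carrier_presented_group one_presented_group mult_presented_group
        word_class_eq_iff)
qed (auto simp: carrier_presented_group one_presented_group mult_presented_group)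

lemma group_BS: "group (BS m n)"
  by (simp add: BS_def group_presented_group)

lemma word_pow_class:
  "word_rel R `` {word_pow x k} = (word_rel R `` {[(x, True)]}) [^]\<^bsub>presented_group R\<^esub> k"
proof -
  interpret G: group "presented_group R" by (rule group_presented_group)
  let ?c = "\<lambda>w. word_rel R `` {w}"
  have closed: "?c w \<in> carrier (presented_group R)" for w
    by (simp add: carrier_presented_group)
  have pow: "?c (replicate i (x, b)) = ?c [(x, b)] [^]\<^bsub>presented_group R\<^esub> i" for i :: nat and b
  proof (induction i)
    case 0
    show ?case by (simp add: one_presented_group)
  next
    case (Suc i)
    show ?case
      by (simp add: mult_presented_group replicate_append_same flip: Suc)
  qed
  have "([(x, False)] @ [(x, True)], []) \<in> word_rel R"
    using word_rel_step[OF word_step.cancel[of R "[]" x False "[]"]] by simp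
  then have "?c [(x, False)] \<otimes>\<^bsub>presented_group R\<^esub> ?c [(x, True)] = \<one>\<^bsub>presented_group R\<^esub>"
    by (simp add: mult_presented_group one_presented_group word_class_eq_iff)
  then have inv: "?c [(x, False)] = inv\<^bsub>presented_group R\<^esub> ?c [(x, True)]"
    by (rule G.inv_equality[OF _ closed closed, symmetric])
  show ?thesis
  proof (cases "0 \<le> k")
    case True
    then show ?thesis
      using pow[of "nat k" True] int_pow_int[of "presented_group R" "?c [(x, True)]" "nat k"]
      by (simp add: word_pow_def)
  next
    case False
    have "word_pow x k = replicate (nat (- k)) (x, False)"
      using False by (simp add: word_pow_def)
    moreover have "?c [(x, True)] [^]\<^bsub>presented_group R\<^esub> k =
        inv\<^bsub>presented_group R\<^esub> (?c [(x, True)] [^]\<^bsub>presented_group R\<^esub> nat (- k))"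
      using False by (subst int_pow_def2) simp
    ultimately show ?thesis
      by (simp only: pow inv G.nat_pow_inv[OF closed])
  qed
qed

lemma BS_relation:
  fixes m n :: int
  defines "G \<equiv> BS m n"
  defines "gen \<equiv> \<lambda>x. word_rel
     {(word_pow bs_gen.t 1 @ word_pow bs_gen.a m @ word_pow bs_gen.t (-1), word_pow bs_gen.a n)} ``
     {[(x, True)]}"
  shows "gen bs_gen.t \<otimes>\<^bsub>G\<^esub> gen bs_gen.a [^]\<^bsub>G\<^esub> m \<otimes>\<^bsub>G\<^esub> inv\<^bsub>G\<^esub> gen bs_gen.t = gen bs_gen.a [^]\<^bsub>G\<^esub> n"
proof -
  let ?t = bs_gen.t and ?a = bs_gen.a
  define R where "R = {(word_pow ?t 1 @ word_pow ?a m @ word_pow ?t (-1), word_pow ?a n)}"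
  have G: "G = presented_group R" by (simp add: G_def BS_def R_def)
  interpret G: group G unfolding G by (rule group_presented_group)
  have gen: "gen x = word_rel R `` {[(x, True)]}" for x by (simp add: gen_def R_def)
  have closed: "gen x \<in> carrier G" for x by (simp add: gen G carrier_presented_group)
  have pow: "word_rel R `` {word_pow x k} = gen x [^]\<^bsub>G\<^esub> k" for x k
    by (simp add: gen G word_pow_class)
  have "word_rel R `` {word_pow ?t 1 @ word_pow ?a m @ word_pow ?t (-1)} = word_rel R `` {word_pow ?a n}"
  proof -
    have "(word_pow ?t 1 @ word_pow ?a m @ word_pow ?t (-1), word_pow ?a n) \<in> R"
      unfolding R_def by (rule singletonI)
    from word_rel_step[OF word_step.relation[OF this, of "[]" "[]"]]
    show ?thesis unfolding word_class_eq_iff append_Nil append_Nil2 .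
  qed
  then have "gen ?t [^]\<^bsub>G\<^esub> (1::int) \<otimes>\<^bsub>G\<^esub> (gen ?a [^]\<^bsub>G\<^esub> m \<otimes>\<^bsub>G\<^esub> gen ?t [^]\<^bsub>G\<^esub> (-1::int)) = gen ?a [^]\<^bsub>G\<^esub> n"
    unfolding pow[symmetric] unfolding G mult_presented_group .
  then show ?thesis
    using closed[of ?t] closed[of ?a] by (simp add: G.int_pow_neg G.m_assoc)
qed

end

theory Submission
  imports Defs "HOL-Library.Countable_Set"
begin

text \<open>
  Let \<open>G = BS(m,n)\<close>. All information on equality in \<open>G\<close> is drawn from one ping-pong action. Let
  \<open>a\<close> translate the first coordinate of \<open>\<Omega> = \<int> \<times> I\<close>, where \<open>I\<close> is countably infinite, and choose two
  halves of \<open>\<Omega>\<close>: a set \<open>Yp\<close> invariant under \<open>a\<^sup>n\<close> and a set \<open>Ym\<close> invariant under \<open>a\<^sup>m\<close>, each moved off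
  itself by all other powers of \<open>a\<close>, with all translates of the one disjoint from the other. Both
  \<open>\<Omega> - Ym\<close> (under \<open>a\<^sup>m\<close>) and \<open>Yp\<close> (under \<open>a\<^sup>n\<close>) are free \<open>\<int>\<close>-sets with countably infinitely many orbits, and so are
  \<open>Ym\<close> and \<open>\<Omega> - Yp\<close>. Hence some bijection \<open>t\<close> with \<open>t a\<^sup>m = a\<^sup>n t\<close> carries \<open>\<Omega> - Ym\<close> onto \<open>Yp\<close>
  (\<open>pingpong_exists\<close>). A shortest word for an element of \<open>G\<close> then sends the base points into the
  translate of a half that its first letters prescribe (\<open>location\<close>). This makes the action faithful,
  and it shows that the minimal number of letters \<open>t\<close> defines the distance function of a tree on the
  cosets of \<open>\<langle>a\<rangle>\<close>, the Bass-Serre tree.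

  Embeddings of \<open>BS(r,s)\<close> are pairs of words \<open>x, y\<close> such that substitution of \<open>x, y\<close> for \<open>a, t\<close>
  preserves and reflects triviality of words (\<open>embeds_iff_subst\<close>).

  \<^bold>\<open>Necessity.\<close> If \<open>y x\<^sup>r = x\<^sup>s y\<close> and \<open>x\<close> fixes no vertex of the tree, then \<open>x\<close> translates an axis. Comparison of
  translation lengths gives \<open>|r| = |s|\<close>, and \<open>y\<^sup>2\<close> commutes with a power of \<open>x\<close>. Therefore
  \<open>y\<^sup>2 x y\<^sup>-\<^sup>2\<close> and \<open>y\<^sup>4 x y\<^sup>-\<^sup>4\<close> translate the same axis by the same amount as \<open>x\<close>, their quotients by \<open>x\<close> lie in
  one vertex stabiliser, and these quotients commute
  (\<open>elliptic_or_commuting\<close>). In \<open>BS(r,s)\<close> with \<open>|r| = |s| \<ge> 2\<close> they do not. So \<open>x\<close> is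
  conjugate to some \<open>a\<^sup>k\<close>, and one may take \<open>x = a\<^sup>k\<close>. The three conditions follow: the first from the affine
  action \<open>q \<mapsto> q + 1\<close>, \<open>q \<mapsto> (n/m) q\<close> on the rationals (\<open>modulus\<close>); the second because, if \<open>p\<^sup>\<alpha>\<close> is the
  exact power of \<open>p\<close> in both \<open>m\<close> and \<open>n\<close>, every element conjugates some \<open>a\<^bsup>N\<^esup>\<close> to a power of \<open>a\<close>,
  both exponents having \<open>p\<close>-part \<open>p\<^sup>\<alpha>\<close> (\<open>prime_power_conj\<close>); the third because, if \<open>m\<close> or \<open>n\<close> is a unit, all conjugates of \<open>a\<^sup>k\<close>
  commute (\<open>conj_commute\<close>).

  \<^bold>\<open>Sufficiency.\<close> By the symmetry \<open>t \<leftrightarrow> t\<^sup>-\<^sup>1\<close> the exponent \<open>k\<close> in the first condition may be taken nonnegative.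
  Write \<open>m = g m'\<close>, \<open>n = g n'\<close> with \<open>g = gcd m n\<close>. The first two conditions give \<open>r = q m'\<^sup>k\<close>, \<open>s = q n'\<^sup>k\<close>, where \<open>q\<close> divides \<open>g (m' n')\<^sup>L\<close> for large \<open>L\<close>
  (\<open>common_part_decomposition\<close>). If \<open>|m|, |n| \<ge> 2\<close>, put \<open>i = g (m' n')\<^sup>L / q\<close>, \<open>x = a\<^sup>i\<close> and let \<open>y\<close> be a
  zigzag \<open>t\<^sup>M a t\<^bsup>-N\<^esup> a t\<^sup>N a\<^sup>-\<^sup>1 t\<^bsup>-N\<^esup> a\<^sup>-\<^sup>1 t\<^sup>M\<close> in the tree with \<open>M = L + k\<close> and \<open>N = M + L\<close>. The lengths of its
  straight pieces are chosen such that, among the powers of \<open>x\<close>, exactly those of \<open>x\<^sup>s\<close> fix the first part of the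
  path from \<open>\<langle>a\<rangle>\<close> to \<open>y\<langle>a\<rangle>\<close>, and exactly those of \<open>x\<^sup>r\<close> fix the first part of the path from \<open>\<langle>a\<rangle>\<close> to \<open>y\<^sup>-\<^sup>1\<langle>a\<rangle>\<close>. So \<open>x, y\<close> play ping-pong themselves, and they
  generate a copy of \<open>BS(r,s)\<close> (\<open>zigzag_pingpong\<close>). If \<open>m\<close> or \<open>n\<close> is a unit, the third condition allows
  \<open>x = a\<close>, \<open>y = t\<^sup>k\<close> (\<open>power_pingpong\<close>).
\<close>

section \<open>Words in the generators\<close>

abbreviation bs_rel :: "int \<Rightarrow> int \<Rightarrow> (bs_gen word \<times> bs_gen word) set" where
  "bs_rel m n \<equiv> {(word_pow bs_gen.t 1 @ word_pow bs_gen.a m @ word_pow bs_gen.t (-1), word_pow bs_gen.a n)}"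

definition bs_eq :: "int \<Rightarrow> int \<Rightarrow> bs_gen word \<Rightarrow> bs_gen word \<Rightarrow> bool" where
  "bs_eq m n u v \<longleftrightarrow> (u, v) \<in> word_rel (bs_rel m n)"

abbreviation apow :: "int \<Rightarrow> bs_gen word" where
  "apow \<equiv> word_pow bs_gen.a"

abbreviation tletter :: "bool \<Rightarrow> bs_gen word" where
  "tletter e \<equiv> [(bs_gen.t, e)]"

definition winv :: "'g word \<Rightarrow> 'g word" where
  "winv w = rev (map (\<lambda>(x, b). (x, \<not> b)) w)"

lemma winv_Nil [simp]: "winv [] = []"
  and winv_append [simp]: "winv (u @ v) = winv v @ winv u"
  and winv_Cons: "winv ((x, b) # w) = winv w @ [(x, \<not> b)]"
  and winv_winv [simp]: "winv (winv w) = w"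
  by (auto simp: winv_def rev_map comp_def case_prod_beta)

lemma bs_eq_refl [simp]: "bs_eq m n u u"
  using equiv_word_rel[of "bs_rel m n"] by (simp add: bs_eq_def equiv_def refl_on_def)

lemma bs_eq_sym: "bs_eq m n u v \<Longrightarrow> bs_eq m n v u"
  using equiv_word_rel[of "bs_rel m n"] unfolding bs_eq_def equiv_def by (meson symD)

lemma bs_eq_trans [trans]: "bs_eq m n u v \<Longrightarrow> bs_eq m n v w \<Longrightarrow> bs_eq m n u w"
  using equiv_word_rel[of "bs_rel m n"] unfolding bs_eq_def equiv_def by (meson transD)

lemma bs_eq_append: "bs_eq m n u u' \<Longrightarrow> bs_eq m n v v' \<Longrightarrow> bs_eq m n (u @ v) (u' @ v')"
  unfolding bs_eq_def by (rule word_rel_append)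

lemma bs_eq_left: "bs_eq m n v v' \<Longrightarrow> bs_eq m n (u @ v) (u @ v')"
  by (rule bs_eq_append) auto

lemma bs_eq_right: "bs_eq m n u u' \<Longrightarrow> bs_eq m n (u @ v) (u' @ v)"
  by (rule bs_eq_append) auto

lemma bs_eq_cancel: "bs_eq m n [(x, b), (x, \<not> b)] []"
  using word_rel_step[OF word_step.cancel[of "bs_rel m n" "[]" x b "[]"]] by (simp add: bs_eq_def)

lemma bs_eq_winv_left: "bs_eq m n (winv w @ w) []"
proof (induction w)
  case (Cons c w)
  obtain x b where c: "c = (x, b)" by fastforce
  have "winv (c # w) @ c # w = winv w @ [(x, \<not> b), (x, \<not> \<not> b)] @ w"
    by (simp add: c winv_Cons)
  moreover have "bs_eq m n (winv w @ [(x, \<not> b), (x, \<not> \<not> b)] @ w) (winv w @ [] @ w)"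
    by (rule bs_eq_left[OF bs_eq_right[OF bs_eq_cancel]])
  ultimately show ?case using Cons bs_eq_trans by fastforce
qed simp

lemma bs_eq_winv_right: "bs_eq m n (w @ winv w) []"
  using bs_eq_winv_left[of m n "winv w"] by simp

lemma bs_eq_winv: assumes "bs_eq m n u v" shows "bs_eq m n (winv u) (winv v)"
proof -
  have "bs_eq m n (winv u) (winv u @ v @ winv v)"
    using bs_eq_left[OF bs_eq_sym[OF bs_eq_winv_right], of m n "winv u" v] by simp
  also have "bs_eq m n \<dots> (winv u @ u @ winv v)"
    by (rule bs_eq_left[OF bs_eq_right[OF bs_eq_sym[OF assms]]])
  also have "bs_eq m n (winv u @ u @ winv v) (winv v)"
    using bs_eq_right[OF bs_eq_winv_left, of m n u "winv v"] by simp
  finally show ?thesis .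
qed

lemma bs_eq_iff_class: "bs_eq m n u v \<longleftrightarrow> word_rel (bs_rel m n) `` {u} = word_rel (bs_rel m n) `` {v}"
  by (simp only: bs_eq_def word_class_eq_iff)

lemma bs_eq_apow_add: "bs_eq m n (apow (i + j)) (apow i @ apow j)"
proof -
  interpret G: group "presented_group (bs_rel m n)" by (rule group_presented_group)
  show ?thesis
    unfolding bs_eq_iff_class mult_presented_group[symmetric] word_pow_class
    by (rule G.int_pow_mult) (simp add: carrier_presented_group)
qed

lemma apow_0 [simp]: "word_pow x 0 = []" by (simp add: word_pow_def)

lemma winv_apow: "bs_eq m n (winv (apow k)) (apow (-k))"
proof -
  have "bs_eq m n (winv (apow k)) (winv (apow k) @ apow k @ apow (-k))"
    using bs_eq_left[OF bs_eq_apow_add[of m n k "-k"], of "winv (apow k)"] by simp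
  also have "bs_eq m n \<dots> (apow (-k))"
    using bs_eq_right[OF bs_eq_winv_left, of m n "apow k" "apow (-k)"] by simp
  finally show ?thesis .
qed

lemma bs_eq_t_apow: "bs_eq m n (tletter True @ apow m) (apow n @ tletter True)"
proof -
  have "(tletter True @ apow m @ tletter False, apow n) \<in> bs_rel m n"
    by (simp add: word_pow_def)
  from word_rel_step[OF word_step.relation[OF this, of "[]" "[]"]]
  have *: "bs_eq m n (tletter True @ apow m @ tletter False) (apow n)" by (simp only: bs_eq_def append_Nil append_Nil2)
  have "bs_eq m n (tletter True @ apow m @ []) (tletter True @ apow m @ tletter False @ tletter True)"
    using bs_eq_left[OF bs_eq_sym[OF bs_eq_cancel], of m n "tletter True @ apow m" bs_gen.t False] by simp
  also have "bs_eq m n \<dots> (apow n @ tletter True)"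
    using bs_eq_right[OF *, of "tletter True"] by simp
  finally show ?thesis by simp
qed

lemma bs_eq_t_apow_mult: "bs_eq m n (tletter True @ apow (m * j)) (apow (n * j) @ tletter True)"
proof (induction j rule: int_induct[where k = 0])
  case base
  show ?case by simp
next
  case (step1 j)
  have "bs_eq m n (tletter True @ apow (m * (j + 1))) (tletter True @ apow m @ apow (m * j))"
    using bs_eq_left[OF bs_eq_apow_add, of m n "tletter True" m "m * j"] by (simp add: algebra_simps)
  also have "bs_eq m n \<dots> ((apow n @ tletter True) @ apow (m * j))"
    using bs_eq_right[OF bs_eq_t_apow, of m n "apow (m * j)"] by simp
  also have "bs_eq m n \<dots> (apow n @ apow (n * j) @ tletter True)"
    using bs_eq_left[OF step1(2), of "apow n"] by simp
  also have "bs_eq m n \<dots> (apow (n * (j + 1)) @ tletter True)"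
    using bs_eq_right[OF bs_eq_sym[OF bs_eq_apow_add], of m n n "n * j" "tletter True"] by (simp add: algebra_simps)
  finally show ?case .
next
  case (step2 j)
  have "bs_eq m n (tletter True @ apow (m * (j - 1))) (apow (-n) @ apow n @ tletter True @ apow (m * (j - 1)))"
    using bs_eq_right[OF bs_eq_apow_add[of m n "-n" n], of "tletter True @ apow (m * (j - 1))"] by simp
  also have "bs_eq m n \<dots> (apow (-n) @ (tletter True @ apow m) @ apow (m * (j - 1)))"
    using bs_eq_left[OF bs_eq_right[OF bs_eq_sym[OF bs_eq_t_apow]], of m n "apow (-n)" "apow (m * (j - 1))"] by simp
  also have "bs_eq m n \<dots> (apow (-n) @ tletter True @ apow (m * j))"
    using bs_eq_left[OF bs_eq_sym[OF bs_eq_apow_add], of m n "apow (-n) @ tletter True" m "m * (j - 1)"] by (simp add: algebra_simps)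
  also have "bs_eq m n \<dots> (apow (-n) @ apow (n * j) @ tletter True)"
    by (rule bs_eq_left[OF step2(2)])
  also have "bs_eq m n \<dots> (apow (n * (j - 1)) @ tletter True)"
    using bs_eq_right[OF bs_eq_sym[OF bs_eq_apow_add], of m n "-n" "n * j" "tletter True"] by (simp add: algebra_simps)
  finally show ?case .
qed

text \<open>
  The powers of \<open>a\<close> that fix the edge of the Bass-Serre tree from \<open>\<langle>a\<rangle>\<close> to \<open>t\<^sup>e\<langle>a\<rangle>\<close> are the powers of
  \<open>a\<^bsup>edge_exp m n e\<^esup>\<close>; a single parameter \<open>e\<close> lets both directions of \<open>t\<close> be treated at once.
\<close>

definition edge_exp :: "int \<Rightarrow> int \<Rightarrow> bool \<Rightarrow> int" where
  "edge_exp m n e = (if e then n else m)"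

lemma bs_eq_tletter_apow:
  "bs_eq m n (tletter e @ apow (edge_exp m n (\<not> e) * j)) (apow (edge_exp m n e * j) @ tletter e)"
proof (cases e)
  case True
  then show ?thesis using bs_eq_t_apow_mult by (simp add: edge_exp_def)
next
  case False
  have "bs_eq m n (tletter False @ apow (n * j)) (tletter False @ apow (n * j) @ tletter True @ tletter False)"
    using bs_eq_left[OF bs_eq_sym[OF bs_eq_cancel], of m n "tletter False @ apow (n * j)" bs_gen.t True] by simp
  also have "bs_eq m n \<dots> (tletter False @ (tletter True @ apow (m * j)) @ tletter False)"
    using bs_eq_left[OF bs_eq_right[OF bs_eq_sym[OF bs_eq_t_apow_mult]], of m n "tletter False" j "tletter False"] by simp
  also have "bs_eq m n \<dots> (apow (m * j) @ tletter False)"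
    using bs_eq_right[OF bs_eq_cancel, of m n bs_gen.t False "apow (m * j) @ tletter False"] by simp
  finally show ?thesis using False by (simp add: edge_exp_def)
qed

lemma bs_eq_pinch:
  "bs_eq m n (tletter e @ apow (edge_exp m n (\<not> e) * j) @ tletter (\<not> e)) (apow (edge_exp m n e * j))"
proof -
  have "bs_eq m n ((tletter e @ apow (edge_exp m n (\<not> e) * j)) @ tletter (\<not> e)) ((apow (edge_exp m n e * j) @ tletter e) @ tletter (\<not> e))"
    by (rule bs_eq_right[OF bs_eq_tletter_apow])
  also have "bs_eq m n \<dots> (apow (edge_exp m n e * j))"
    using bs_eq_left[OF bs_eq_cancel, of m n "apow (edge_exp m n e * j)" bs_gen.t e] by simp
  finally show ?thesis by simp
qed

lemma bs_eq_iff_quotient: "bs_eq m n u v \<longleftrightarrow> bs_eq m n (winv u @ v) []"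
proof
  assume "bs_eq m n u v"
  then have "bs_eq m n (winv u @ v) (winv u @ u)" by (rule bs_eq_left[OF bs_eq_sym])
  then show "bs_eq m n (winv u @ v) []" using bs_eq_trans bs_eq_winv_left by blast
next
  assume *: "bs_eq m n (winv u @ v) []"
  have "bs_eq m n u (u @ winv u @ v)" using bs_eq_left[OF bs_eq_sym[OF *], of u] by simp
  also have "bs_eq m n \<dots> v" using bs_eq_right[OF bs_eq_winv_right[of m n u], of v] by simp
  finally show "bs_eq m n u v" .
qed

section \<open>Actions of Baumslag-Solitar groups\<close>

abbreviation finv :: "('w \<Rightarrow> 'w) \<Rightarrow> 'w \<Rightarrow> 'w" where
  "finv f \<equiv> inv_into UNIV f"

fun letter_act :: "(int \<Rightarrow> 'w \<Rightarrow> 'w) \<Rightarrow> ('w \<Rightarrow> 'w) \<Rightarrow> bs_gen \<times> bool \<Rightarrow> 'w \<Rightarrow> 'w" where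
  "letter_act A T (bs_gen.a, b) = A (if b then 1 else - 1)"
| "letter_act A T (bs_gen.t, b) = (if b then T else finv T)"

declare letter_act.simps(2) [simp del]

primrec word_act :: "(int \<Rightarrow> 'w \<Rightarrow> 'w) \<Rightarrow> ('w \<Rightarrow> 'w) \<Rightarrow> bs_gen word \<Rightarrow> 'w \<Rightarrow> 'w" where
  "word_act A T [] = id"
| "word_act A T (c # w) = letter_act A T c \<circ> word_act A T w"

lemma word_act_append: "word_act A T (u @ v) = word_act A T u \<circ> word_act A T v"
  by (induction u) (auto simp: comp_assoc)

text \<open>
  The action of the generator \<open>a\<close> is given with all its powers, so that an action of \<open>\<langle>a\<^sup>i\<rangle>\<close> is again
  of this form.
\<close>

locale bs_action =
  fixes A :: "int \<Rightarrow> 'w \<Rightarrow> 'w" and T :: "'w \<Rightarrow> 'w" and m n :: int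
  assumes A_zero [simp]: "A 0 w = w"
    and A_add: "A (i + j) w = A i (A j w)"
    and bij_T: "bij T"
    and T_A: "T (A m w) = A n (T w)"
begin

abbreviation act :: "bs_gen word \<Rightarrow> 'w \<Rightarrow> 'w" where
  "act \<equiv> word_act A T"

definition t_act :: "bool \<Rightarrow> 'w \<Rightarrow> 'w" where
  "t_act e = (if e then T else finv T)"

lemma A_neg_A [simp]: "A (- k) (A k w) = w" "A k (A (- k) w) = w"
  using A_add[of "-k" k w] A_add[of k "-k" w] by simp_all

lemma A_comm: "A i (A j w) = A j (A i w)"
  using A_add[of i j w] A_add[of j i w] by (simp add: add.commute)

lemma T_inv_T [simp]: "T (finv T w) = w" "finv T (T w) = w"
  using bij_T by (simp_all add: bij_is_surj surj_f_inv_f bij_is_inj)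

lemma t_act_t_act [simp]: "t_act e (t_act (\<not> e) w) = w" "t_act (\<not> e) (t_act e w) = w"
  by (simp_all add: t_act_def)

lemma letter_act_cancel: "letter_act A T (x, b) (letter_act A T (x, \<not> b) w) = w"
  using A_neg_A[of 1] by (cases x) (simp_all add: letter_act.simps(2))

lemma letter_act_t [simp]: "letter_act A T (bs_gen.t, e) = t_act e"
  by (simp add: t_act_def letter_act.simps)

lemma act_replicate: "act (replicate i (bs_gen.a, b)) w = A (if b then int i else - int i) w"
proof (induction i)
  case (Suc i)
  then show ?case using A_add[of 1 "int i" w] A_add[of "-1" "- int i" w] by (cases b) simp_all
qed simp

lemma act_apow [simp]: "act (apow k) = A k"
  by (rule ext) (simp add: word_pow_def act_replicate)

lemma act_winv_act [simp]: "act (winv u) (act u w) = w"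
proof (induction u arbitrary: w)
  case (Cons c u)
  obtain x b where "c = (x, b)" by fastforce
  then show ?case using letter_act_cancel[of x "\<not> b" "act u w"] Cons
    by (simp add: winv_Cons word_act_append)
qed simp

lemma act_act_winv [simp]: "act u (act (winv u) w) = w"
  using act_winv_act[of "winv u" w] by simp

lemma act_eq_iff: "act u w = act u w' \<longleftrightarrow> w = w'"
  by (metis act_winv_act)

lemma bij_act: "bij (act u)"
  by (rule bijI') (auto simp: act_eq_iff intro: act_act_winv[symmetric])

lemma act_word_step:
  assumes "word_step (bs_rel m n) u v"
  shows "act u = act v"
  using assms
proof cases
  case (cancel p x b q)
  then show ?thesis using letter_act_cancel by (auto simp: word_act_append fun_eq_iff)
next
  case (relation l r p q)
  have "act l = act r"
  proof
    fix w
    have "T (A m (finv T w)) = A n w" by (simp add: T_A)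
    then show "act l w = act r w" using relation(3) by (auto simp: word_act_append word_pow_def[of bs_gen.t] t_act_def)
  qed
  then show ?thesis unfolding relation(1,2) word_act_append by simp
qed

text \<open>
  The universal property of the presentation.
\<close>

lemma act_cong: "bs_eq m n u v \<Longrightarrow> act u = act v"
  unfolding bs_eq_def word_rel_def mem_Collect_eq prod.case
  by (induction rule: equivclp_induct) (use act_word_step in fastforce)+

end

definition wpow :: "'g word \<Rightarrow> int \<Rightarrow> 'g word" where
  "wpow x k = concat (replicate (nat \<bar>k\<bar>) (if 0 \<le> k then x else winv x))"

context bs_action
begin

lemma act_wpow_Suc: "act (wpow x (k + 1)) w = act x (act (wpow x k) w)"
proof (cases "0 \<le> k")
  case True
  then have "nat \<bar>k + 1\<bar> = Suc (nat \<bar>k\<bar>)" by simp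
  then show ?thesis using True by (simp add: wpow_def word_act_append)
next
  case False
  then have "nat \<bar>k\<bar> = Suc (nat \<bar>k + 1\<bar>)" by simp
  then have "wpow x k = winv x @ wpow x (k + 1)"
    using False by (cases "k = -1") (simp_all add: wpow_def)
  then show ?thesis by (simp add: word_act_append)
qed

lemma wpow_action: "act (wpow x (i + j)) w = act (wpow x i) (act (wpow x j) w)"
proof (induction i rule: int_induct[where k = 0])
  case base
  show ?case by (simp add: wpow_def)
next
  case (step1 i)
  then show ?case using act_wpow_Suc[of x "i + j" w] act_wpow_Suc[of x i] by (simp add: algebra_simps)
next
  case (step2 i)
  then have "act x (act (wpow x (i - 1 + j)) w) = act x (act (wpow x (i - 1)) (act (wpow x j) w))"
    using act_wpow_Suc[of x "i - 1 + j" w] act_wpow_Suc[of x "i - 1"] by (simp add: algebra_simps)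
  then show ?case by (simp add: act_eq_iff)
qed

lemma act_winv_apow [simp]: "act (winv (apow k)) = A (- k)"
  using act_cong[OF winv_apow] by simp

lemma act_winv_tletter [simp]: "act (winv (tletter e)) = t_act (\<not> e)"
  by (simp add: winv_def)

lemma t_act_A: "t_act e (A (edge_exp m n (\<not> e) * j) w) = A (edge_exp m n e * j) (t_act e w)"
  using act_cong[OF bs_eq_tletter_apow, of e j] by (auto simp: word_act_append fun_eq_iff)

lemma T_A_mult: "T (A (m * j) w) = A (n * j) (T w)"
  using t_act_A[of True j w] by (simp add: edge_exp_def t_act_def)

lemma TT_A: "T (T (A (m * m * j) w)) = A (n * n * j) (T (T w))"
  using T_A_mult[of "m * j" w] T_A_mult[of "n * j" "T w"] by (simp add: mult.assoc mult.left_commute)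

text \<open>
  Words \<open>x, y\<close> that satisfy the defining relation of \<open>BS(r,s)\<close> make any \<open>BS(m,n)\<close>-set into a
  \<open>BS(r,s)\<close>-set.
\<close>

lemma derived_action:
  assumes "\<And>w. act y (act (wpow x r) w) = act (wpow x s) (act y w)"
  shows "bs_action (\<lambda>k. act (wpow x k)) (act y) r s"
  by unfold_locales (use assms in \<open>simp_all add: wpow_action bij_act wpow_def[of _ 0]\<close>)

lemma act_funpow_append: "act (((@) x ^^ k) u) w = act (wpow x (int k)) (act u w)"
proof (induction k)
  case 0
  show ?case by (simp add: wpow_def)
next
  case (Suc k)
  then show ?case using act_wpow_Suc[of x "int k"] by (simp add: word_act_append add.commute)
qed

end

text \<open>
  \<open>BS(m,n)\<close> and \<open>BS(n,m)\<close> are the same group with \<open>t\<close> and \<open>t\<^sup>-\<^sup>1\<close> interchanged.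
\<close>

definition flip_t :: "bs_gen word \<Rightarrow> bs_gen word" where
  "flip_t w = map (\<lambda>(x, b). (x, if x = bs_gen.t then \<not> b else b)) w"

lemma (in bs_action) act_flip_t: "word_act A (finv T) w = act (flip_t w)"
proof (induction w)
  case (Cons c w)
  have "finv (finv T) = T" using bij_T by (rule inv_inv_eq)
  then have "letter_act A (finv T) c = act (flip_t [c])"
    by (cases c; cases "fst c") (auto simp: flip_t_def letter_act.simps(2) simp del: letter_act_t)
  then show ?case using Cons word_act_append[of A T "flip_t [c]" "flip_t w"] by (simp add: flip_t_def)
qed (simp add: flip_t_def)

context bs_action
begin

lemma finv_act: "finv (act y) = act (winv y)"
  by (rule inv_equality) simp_all

lemma act_wpow_apow: "act (wpow (apow i) k) = A (i * k)"
proof (induction k rule: int_induct[where k = 0])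
  case base
  show ?case by (auto simp: wpow_def)
next
  case (step1 k)
  then show ?case using act_wpow_Suc[of "apow i" k] A_add[of i "i * k"] by (auto simp: fun_eq_iff algebra_simps)
next
  case (step2 k)
  then have "A i (act (wpow (apow i) (k - 1)) w) = A i (A (i * (k - 1)) w)" for w
    using act_wpow_Suc[of "apow i" "k - 1" w] A_add[of i "i * (k - 1)" w] by (simp add: algebra_simps)
  then show ?case using act_eq_iff[of "apow i"] by (auto simp: fun_eq_iff)
qed

lemma T_pow_inv_T_pow: "(T ^^ j) ((finv T ^^ j) w) = w" "(finv T ^^ j) ((T ^^ j) w) = w"
  by (induction j arbitrary: w) (simp_all add: funpow_swap1)

lemma act_t_powers:
  "act (replicate j (bs_gen.t, True)) = T ^^ j" "act (replicate j (bs_gen.t, False)) = finv T ^^ j"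
  by (induction j) (auto simp: t_act_def fun_eq_iff)

text \<open>
  After removal of the common factor \<open>g\<close> from \<open>m\<close> and \<open>n\<close>, passing \<open>t\<^sup>j\<close> costs a single factor \<open>g\<close> instead of
  \<open>g\<^sup>j\<close>.
\<close>

lemma T_pow_A:
  assumes "m = g * m'" "n = g * n'"
  shows "(T ^^ j) (A (g * m' ^ j * c) w) = A (g * n' ^ j * c) ((T ^^ j) w)"
proof (induction j arbitrary: c w)
  case (Suc j)
  have "T (A (g * m' ^ Suc j * c) w) = A (g * m' ^ j * (n' * c)) (T w)"
    using T_A_mult[of "m' ^ j * c" w] by (simp add: assms mult_ac)
  then have "(T ^^ Suc j) (A (g * m' ^ Suc j * c) w) = (T ^^ j) (A (g * m' ^ j * (n' * c)) (T w))"
    by (simp add: funpow_Suc_right del: funpow.simps)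
  also have "\<dots> = A (g * n' ^ Suc j * c) ((T ^^ Suc j) w)"
    unfolding Suc by (simp add: funpow_Suc_right mult_ac del: funpow.simps)
  finally show ?case .
qed simp

end

lemma flip_t_flip_t: "flip_t (flip_t w) = w"
  by (induction w) (auto simp: flip_t_def split: if_splits)

section \<open>The number of letters t and the height\<close>

definition tcount :: "bs_gen word \<Rightarrow> nat" where
  "tcount w = length (filter (\<lambda>c. fst c = bs_gen.t) w)"

text \<open>
  The distance from \<open>\<langle>a\<rangle>\<close> to \<open>w\<langle>a\<rangle>\<close> in the Bass-Serre tree.
\<close>

definition tlen :: "int \<Rightarrow> int \<Rightarrow> bs_gen word \<Rightarrow> nat" where
  "tlen m n w = (LEAST l. \<exists>w'. bs_eq m n w w' \<and> tcount w' = l)"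

lemma tcount_append [simp]: "tcount (u @ v) = tcount u + tcount v"
  by (simp add: tcount_def)

lemma tcount_winv [simp]: "tcount (winv w) = tcount w"
  by (induction w) (auto simp: tcount_def winv_def)

lemma tcount_apow [simp]: "tcount (apow k) = 0"
  by (simp add: tcount_def word_pow_def)

lemma tcount_tletter [simp]: "tcount (tletter e) = 1"
  by (simp add: tcount_def)

lemma tlen_witness: obtains w' where "bs_eq m n w w'" "tcount w' = tlen m n w"
proof -
  have "\<exists>w'. bs_eq m n w w' \<and> tcount w' = tlen m n w"
    unfolding tlen_def by (rule LeastI_ex) (meson bs_eq_refl)
  then show ?thesis using that by blast
qed

lemma tlen_le: "bs_eq m n w w' \<Longrightarrow> tlen m n w \<le> tcount w'"
  unfolding tlen_def by (rule Least_le) blast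

lemma tlen_cong: "bs_eq m n u v \<Longrightarrow> tlen m n u = tlen m n v"
  unfolding tlen_def using bs_eq_sym bs_eq_trans by (intro arg_cong[where f = Least] ext) blast

lemma tlen_append: "tlen m n (u @ v) \<le> tlen m n u + tlen m n v"
proof -
  obtain u' v' where "bs_eq m n u u'" "tcount u' = tlen m n u" "bs_eq m n v v'" "tcount v' = tlen m n v"
    using tlen_witness by metis
  then show ?thesis using tlen_le[OF bs_eq_append] by fastforce
qed

lemma tlen_winv [simp]: "tlen m n (winv w) = tlen m n w"
proof -
  have "tlen m n (winv w) \<le> tlen m n w" for w
    using tlen_witness[of m n w] tlen_le[OF bs_eq_winv] by (metis tcount_winv)
  from this[of w] this[of "winv w"] show ?thesis by simp
qed

lemma tlen_apow [simp]: "tlen m n (apow k) = 0"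
  using tlen_le[OF bs_eq_refl, of m n "apow k"] by simp

lemma tcount_0_apow: "tcount w = 0 \<Longrightarrow> \<exists>k. bs_eq m n w (apow k)"
proof (induction w)
  case Nil
  show ?case using bs_eq_refl[of m n "[]"] by (metis apow_0)
next
  case (Cons c w)
  obtain x b where c: "c = (x, b)" by fastforce
  have x: "x = bs_gen.a" using Cons.prems c by (cases x) (auto simp: tcount_def)
  obtain k where k: "bs_eq m n w (apow k)" using Cons by (auto simp: tcount_def split: if_splits)
  have "bs_eq m n (c # w) (apow (if b then 1 else -1) @ apow k)"
    using bs_eq_left[OF k, of "[c]"] unfolding c x by (cases b) (simp_all add: word_pow_def[of _ 1] word_pow_def[of _ "- 1"])
  then show ?case using bs_eq_sym[OF bs_eq_apow_add] bs_eq_trans by blast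
qed

lemma tlen_0_iff: "tlen m n w = 0 \<longleftrightarrow> (\<exists>k. bs_eq m n w (apow k))"
  using tlen_witness[of m n w] tcount_0_apow tlen_cong[of m n w] bs_eq_trans tlen_apow by metis

lemma tcount_SucE:
  assumes "tcount w = Suc l"
  obtains p e q where "w = p @ tletter e @ q" "tcount p = 0" "tcount q = l"
  using assms
proof (induction w arbitrary: thesis)
  case (Cons c w)
  obtain x b where c: "c = (x, b)" by fastforce
  show ?case
  proof (cases x)
    case a
    then have "tcount w = Suc l" using Cons.prems(2) c by (simp add: tcount_def)
    then obtain p e q where "w = p @ tletter e @ q" "tcount p = 0" "tcount q = l"
      using Cons.IH by blast
    then show ?thesis using Cons.prems(1)[of "c # p" e q] a c by (simp add: tcount_def)
  next
    case t
    then show ?thesis using Cons.prems(1)[of "[]" b w] Cons.prems(2) c by (simp add: tcount_def)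
  qed
qed (simp add: tcount_def)

text \<open>
  The first edge of a geodesic: a shortest word is cut after its first letter \<open>t\<^bsup>\<plusminus>1\<^esup>\<close>.
\<close>

lemma tlen_SucE:
  assumes "tlen m n w = Suc l"
  obtains k e w' where "bs_eq m n w (apow k @ tletter e @ w')" "tlen m n w' = l"
proof -
  obtain v where v: "bs_eq m n w v" "tcount v = Suc l" using tlen_witness assms by metis
  obtain p e q where v_eq: "v = p @ tletter e @ q" "tcount p = 0" "tcount q = l"
    using tcount_SucE[OF v(2)] by blast
  obtain k where k: "bs_eq m n p (apow k)" using tcount_0_apow v_eq(2) by blast
  have w: "bs_eq m n w (apow k @ tletter e @ q)"
    using bs_eq_trans[OF v(1)] bs_eq_right[OF k] v_eq(1) by blast
  have "Suc l \<le> Suc (tlen m n q)"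
    using tlen_append[of m n "apow k" "tletter e @ q"] tlen_append[of m n "tletter e" q]
      tlen_le[OF bs_eq_refl, of m n "tletter e"] assms tlen_cong[OF w] by simp
  moreover have "tlen m n q \<le> l" using tlen_le[OF bs_eq_refl, of m n q] v_eq(3) by simp
  ultimately show ?thesis using that w by force
qed

primrec height :: "bs_gen word \<Rightarrow> int" where
  "height [] = 0"
| "height (c # w) = (case c of (bs_gen.a, b) \<Rightarrow> 0 | (bs_gen.t, b) \<Rightarrow> if b then 1 else - 1) + height w"

lemma height_append [simp]: "height (u @ v) = height u + height v"
  by (induction u) auto

lemma height_apow [simp]: "height (apow k) = 0"
proof -
  have "height (replicate i (bs_gen.a, b)) = 0" for i b by (induction i) auto
  then show ?thesis by (simp add: word_pow_def)
qed

text \<open>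
  The exponent sum of \<open>t\<close> is realised by the action on \<open>\<int>\<close> in which \<open>a\<close> is trivial and \<open>t\<close> is the
  successor function.
\<close>

lemma height_cong: 
  assumes "bs_eq m n u v" shows "height u = height v"
proof -
  interpret bs_action "\<lambda>k z. z" "\<lambda>z::int. z + 1" m n
    by unfold_locales (auto intro: bij_betwI[where g = "\<lambda>z. z - 1"])
  have "finv (\<lambda>z::int. z + 1) = (\<lambda>z. z - 1)" by (rule inv_equality) auto
  then have "letter_act (\<lambda>k z. z) (\<lambda>z::int. z + 1) (bs_gen.t, e) z = (if e then 1 else - 1) + z" for e z
    by (simp add: t_act_def)
  then have "act w z = height w + z" for w z
    by (induction w) (auto split: bs_gen.split prod.split simp del: letter_act_t)
  then show ?thesis using act_cong[OF assms] by (metis add.right_neutral)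
qed

lemma height_winv [simp]: "height (winv w) = - height w"
  using height_cong[OF bs_eq_winv_left[of 1 1 w]] by simp

lemma even_tlen_height: "even (int (tlen m n w) + height w)"
proof -
  have "even (int (tcount w) + height w)" for w
  proof (induction w)
    case (Cons c w)
    then show ?case by (cases c; cases "fst c") (auto simp: tcount_def)
  qed (simp add: tcount_def)
  then show ?thesis using tlen_witness[of m n w] height_cong by metis
qed

section \<open>Ping-pong and normal forms\<close>

text \<open>
  The sets \<open>Yp\<close> and \<open>Ym\<close> play the role of the half-trees beyond the edges from \<open>\<langle>a\<rangle>\<close> to \<open>t\<langle>a\<rangle>\<close> and to
  \<open>t\<^sup>-\<^sup>1\<langle>a\<rangle>\<close>, and \<open>B\<close> that of the base vertex; \<open>\<langle>a\<rangle>\<close> acts freely instead of fixing \<open>B\<close> pointwise, so that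
  powers of \<open>a\<close> are detected as well.
\<close>

locale pingpong = bs_action A T m n
  for A :: "int \<Rightarrow> 'w \<Rightarrow> 'w" and T m n +
  fixes Yp Ym B :: "'w set"
  assumes T_in_Yp_iff: "T w \<in> Yp \<longleftrightarrow> w \<notin> Ym"
    and Yp_Ym: "w \<in> Yp \<Longrightarrow> A k w \<notin> Ym"
    and Yp_free: "w \<in> Yp \<Longrightarrow> A k w \<in> Yp \<Longrightarrow> n dvd k"
    and Ym_free: "w \<in> Ym \<Longrightarrow> A k w \<in> Ym \<Longrightarrow> m dvd k"
    and B_A: "w \<in> B \<Longrightarrow> A k w \<in> B"
    and B_ne: "B \<noteq> {}"
    and B_Y: "w \<in> B \<Longrightarrow> w \<notin> Yp \<and> w \<notin> Ym"
    and A_free: "A k w = w \<Longrightarrow> k = 0"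
begin

definition Y :: "bool \<Rightarrow> 'w set" where
  "Y e = (if e then Yp else Ym)"

lemma t_act_in_Y_iff: "t_act e w \<in> Y e \<longleftrightarrow> w \<notin> Y (\<not> e)"
  using T_in_Yp_iff[of w] T_in_Yp_iff[of "finv T w"] by (auto simp: t_act_def Y_def)

lemma Y_disjoint: "w \<in> Y e \<Longrightarrow> A k w \<notin> Y (\<not> e)"
  using Yp_Ym[of w k] Yp_Ym[of "A k w" "- k"] by (auto simp: Y_def split: if_splits)

lemma Y_free: "w \<in> Y e \<Longrightarrow> A k w \<in> Y e \<Longrightarrow> edge_exp m n e dvd k"
  using Yp_free Ym_free by (auto simp: Y_def edge_exp_def split: if_splits)

text \<open>
  Britton's lemma in the form needed here. The only way in which \<open>t\<^sup>e\<close> can fail to push the image of a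
  base point into \<open>Y e\<close> is that \<open>w'\<close> begins with \<open>a\<^bsup>k'\<^esup> t\<^bsup>-e\<^esup>\<close> where \<open>a\<^bsup>k'\<^esup>\<close> fixes the edge; but then \<open>t\<^sup>e a\<^bsup>k'\<^esup> t\<^bsup>-e\<^esup>\<close> is
  a power of \<open>a\<close> and \<open>w\<close> was not shortest.
\<close>

lemma location:
  assumes "tlen m n w = Suc l" "bs_eq m n w (apow k @ tletter e @ w')" "tlen m n w' = l" "b \<in> B"
  shows "A (- k) (act w b) \<in> Y e"
  using assms
proof (induction l arbitrary: w k e w')
  case 0
  obtain j where j: "bs_eq m n w' (apow j)" using 0(3) tlen_0_iff by blast
  have "A j b \<notin> Y (\<not> e)" using B_Y B_A 0 by (auto simp: Y_def)
  then have "t_act e (A j b) \<in> Y e" by (simp add: t_act_in_Y_iff)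
  moreover have "act w b = A k (t_act e (A j b))"
    using act_cong[OF 0(2)] act_cong[OF j] by (simp add: word_act_append)
  ultimately show ?case by simp
next
  case (Suc l)
  obtain k' e' w'' where w': "bs_eq m n w' (apow k' @ tletter e' @ w'')" "tlen m n w'' = l"
    using tlen_SucE[OF Suc.prems(3)] by blast
  define z where "z = A (- k') (act w' b)"
  have z: "z \<in> Y e'" unfolding z_def using Suc.IH[OF Suc.prems(3) w' Suc.prems(4)] .
  have w'b: "act w' b = A k' z" by (simp add: z_def)
  have "act w' b \<notin> Y (\<not> e)"
  proof (cases "e' = e")
    case True
    then show ?thesis using Y_disjoint[OF z, of k'] w'b by simp
  next
    case False
    then have e': "e' = (\<not> e)" by simp
    show ?thesis
    proof
      assume "act w' b \<in> Y (\<not> e)"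
      then have "edge_exp m n e' dvd k'" using Y_free[OF z, of k'] w'b e' by simp
      then obtain j where j: "k' = edge_exp m n (\<not> e) * j" using e' by (auto simp: dvd_def)
      have "bs_eq m n w (apow k @ tletter e @ apow k' @ tletter (\<not> e) @ w'')"
        using bs_eq_trans[OF Suc.prems(2)] bs_eq_left[OF w'(1), of "apow k @ tletter e"] e' by simp
      also have "bs_eq m n \<dots> (apow k @ apow (edge_exp m n e * j) @ w'')"
        using bs_eq_left[OF bs_eq_right[OF bs_eq_pinch], of m n "apow k" e j w''] j by simp
      finally have "tlen m n w \<le> l"
        using tlen_cong[of m n w] tlen_append[of m n "apow k" "apow (edge_exp m n e * j) @ w''"]
          tlen_append[of m n "apow (edge_exp m n e * j)" w''] w'(2) by simp
      then show False using Suc.prems(1) by simp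
    qed
  qed
  then have "t_act e (act w' b) \<in> Y e" by (simp add: t_act_in_Y_iff)
  moreover have "act w b = A k (t_act e (act w' b))"
    using act_cong[OF Suc.prems(2)] by (simp add: word_act_append)
  ultimately show ?case by simp
qed

text \<open>
  Faithfulness: a word with a positive number of necessary letters \<open>t\<close> moves base points out of \<open>B\<close>,
  and a nonzero power of \<open>a\<close> has no fixed points.
\<close>

lemma act_id_imp: assumes "act w = id" shows "bs_eq m n w []"
proof -
  obtain b where b: "b \<in> B" using B_ne by blast
  show ?thesis
  proof (cases "tlen m n w")
    case 0
    then obtain k where k: "bs_eq m n w (apow k)" using tlen_0_iff by blast
    then have "A k b = b" using act_cong[OF k] assms by simp
    then show ?thesis using A_free k by fastforce
  next
    case (Suc l)
    then obtain k e w' where "bs_eq m n w (apow k @ tletter e @ w')" "tlen m n w' = l"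
      using tlen_SucE by blast
    from location[OF Suc this b] have "A (- k) b \<in> Y e" using assms by simp
    then show ?thesis using B_Y[OF B_A[OF b, of "- k"]] by (auto simp: Y_def split: if_splits)
  qed
qed

lemma act_eq_iff_bs_eq: "act u = act v \<longleftrightarrow> bs_eq m n u v"
proof
  assume "act u = act v"
  then have "act (winv u @ v) = id" by (auto simp: word_act_append fun_eq_iff) (metis act_winv_act)
  then show "bs_eq m n u v" using act_id_imp bs_eq_iff_quotient by blast
qed (rule act_cong)

lemma dual: "pingpong A (finv T) n m Ym Yp B"
proof unfold_locales
  show "bij (finv T)" using bij_T by (rule bij_imp_bij_inv)
  show "finv T (A n w) = A m (finv T w)" for w
    using T_A[of "finv T w"] by (metis T_inv_T)
  show "finv T w \<in> Ym \<longleftrightarrow> w \<notin> Yp" for w using T_in_Yp_iff[of "finv T w"] by auto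
  show "A k w \<notin> Yp" if "w \<in> Ym" for w k using Yp_Ym[of "A k w" "- k"] that by auto
qed (use A_add Yp_free Ym_free B_A B_ne B_Y A_free in auto)

lemma finv_T_in_Ym_iff: "finv T w \<in> Ym \<longleftrightarrow> w \<notin> Yp"
  using T_in_Yp_iff[of "finv T w"] by auto

lemma Ym_Yp: "w \<in> Ym \<Longrightarrow> A k w \<notin> Yp"
  using Yp_Ym[of "A k w" "- k"] by auto

end

section \<open>Existence of a ping-pong action\<close>

text \<open>
  The index component \<open>(Some e, j)\<close> labels the orbits of \<open>\<langle>a\<rangle>\<close> that meet the half \<open>Y e\<close>; the orbits labelled
  \<open>(None, j)\<close> consist of base points.
\<close>

type_synonym bs_point = "int \<times> (bool option \<times> nat)"

definition shift :: "int \<Rightarrow> int \<times> 'i \<Rightarrow> int \<times> 'i" where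
  "shift k w = (fst w + k, snd w)"

definition half :: "int \<Rightarrow> bool \<Rightarrow> bs_point set" where
  "half q e = {(z, (c, j)). c = Some e \<and> q dvd z}"

lemma shift_half_iff: "shift q w \<in> half q e \<longleftrightarrow> w \<in> half q e"
  by (auto simp: half_def shift_def split: prod.splits)

lemma half_equivariant_bij:
  assumes "q \<noteq> 0"
  shows "\<exists>\<psi> :: bs_point \<Rightarrow> int \<times> nat.
    bij_betw \<psi> (half q e) UNIV \<and> (\<forall>w\<in>half q e. \<psi> (shift q w) = shift 1 (\<psi> w))"
proof (intro exI conjI ballI)
  let ?\<psi> = "\<lambda>w::bs_point. (fst w div q, snd (snd w))"
  show "bij_betw ?\<psi> (half q e) UNIV"
    by (rule bij_betwI[where g = "\<lambda>(z, j). (q * z, (Some e, j))"])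
      (use assms in \<open>auto simp: half_def\<close>)
  show "?\<psi> (shift q w) = shift 1 (?\<psi> w)" for w
    using assms by (simp add: shift_def)
qed

text \<open>
  The complement of a half is a free \<open>q\<int>\<close>-set. Remainders modulo \<open>q\<close> give a set \<open>J\<close> of orbit
  representatives, which is infinite because all base points with first coordinate 0 belong to it; so its orbits can be
  numbered by the natural numbers.
\<close>

lemma compl_half_equivariant_bij:
  assumes "q \<noteq> 0"
  shows "\<exists>\<phi> :: bs_point \<Rightarrow> int \<times> nat.
    bij_betw \<phi> (- half q e) UNIV \<and> (\<forall>w. \<phi> (shift q w) = shift 1 (\<phi> w))"
proof -
  define J where "J = {(z mod q, i) | z i. (z, i) \<notin> half q e}"
  have "range (\<lambda>j::nat. (0::int, (None :: bool option, j))) \<subseteq> J"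
    unfolding J_def half_def by (auto intro: exI[of _ 0])
  moreover have "infinite (range (\<lambda>j::nat. (0::int, (None :: bool option, j))))"
    by (rule range_inj_infinite) (auto intro: injI)
  ultimately have "infinite J" using finite_subset by blast
  then obtain f where f: "bij_betw f J (UNIV :: nat set)"
    using countableE_infinite[of J] countableI_type[of J] by blast
  define g where "g = inv_into J f"
  have gf: "g (f x) = x" if "x \<in> J" for x
    using bij_betw_inv_into_left[OF f that] by (simp add: g_def)
  have fg: "f (g j) = j" and g_J: "g j \<in> J" for j
    using bij_betw_inv_into_right[OF f, of j] inv_into_into[of j f J] f by (auto simp: g_def bij_betw_def)
  have mod_g: "fst (g j) mod q = fst (g j)" for j
    using g_J[of j] by (auto simp: J_def)
  have out: "(q * z + fst (g j), snd (g j)) \<notin> half q e" for z j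
  proof -
    obtain y i where y: "g j = (y mod q, i)" "(y, i) \<notin> half q e" using g_J[of j] by (auto simp: J_def)
    have "q dvd q * z + y mod q \<longleftrightarrow> q dvd y" by (simp add: dvd_add_right_iff dvd_mod_iff)
    then show ?thesis using y by (auto simp: half_def)
  qed
  let ?\<phi> = "\<lambda>w::bs_point. (fst w div q, f (fst w mod q, snd w))"
  have "bij_betw ?\<phi> (- half q e) UNIV"
  proof (rule bij_betwI[where g = "\<lambda>(z, j). (q * z + fst (g j), snd (g j))"])
    show "(case ?\<phi> w of (z, j) \<Rightarrow> (q * z + fst (g j), snd (g j))) = w" if "w \<in> - half q e" for w
    proof -
      have "(fst w mod q, snd w) \<in> J" using that unfolding J_def by (cases w) auto
      then show ?thesis by (simp add: gf)
    qed
    show "?\<phi> (case y of (z, j) \<Rightarrow> (q * z + fst (g j), snd (g j))) = y" for y :: "int \<times> nat"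
    proof (cases y)
      case (Pair z j)
      have "fst (g j) div q = 0" using mult_div_mod_eq[of q "fst (g j)"] mod_g[of j] assms by simp
      then have "(q * z + fst (g j)) div q = z" using assms by simp
      moreover have "(q * z + fst (g j)) mod q = fst (g j)" using mod_g[of j] by simp
      ultimately show ?thesis using Pair by (simp add: fg)
    qed
  qed (use out in auto)
  moreover have "?\<phi> (shift q w) = shift 1 (?\<phi> w)" for w
    using assms by (simp add: shift_def)
  ultimately show ?thesis by blast
qed

text \<open>
  The bijection \<open>T\<close> is glued from two equivariant bijections between free \<open>\<int>\<close>-sets with countably infinitely
  many orbits, \<open>\<Omega> - Ym \<rightarrow> Yp\<close> and \<open>Ym \<rightarrow> \<Omega> - Yp\<close>.
\<close>

theorem pingpong_exists:
  assumes "m \<noteq> 0" "n \<noteq> 0"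
  obtains T :: "bs_point \<Rightarrow> bs_point" and Yp Ym B where "pingpong shift T m n Yp Ym B"
proof -
  let ?Ym = "half m False" and ?Yp = "half n True"
  obtain \<phi>m :: "bs_point \<Rightarrow> int \<times> nat" where \<phi>m: "bij_betw \<phi>m (- ?Ym) UNIV" "\<And>w. \<phi>m (shift m w) = shift 1 (\<phi>m w)"
    using compl_half_equivariant_bij[OF assms(1)] by blast
  obtain \<psi>m :: "bs_point \<Rightarrow> int \<times> nat" where \<psi>m: "bij_betw \<psi>m ?Ym UNIV" "\<And>w. w \<in> ?Ym \<Longrightarrow> \<psi>m (shift m w) = shift 1 (\<psi>m w)"
    using half_equivariant_bij[OF assms(1)] by blast
  obtain \<phi>n :: "bs_point \<Rightarrow> int \<times> nat" where \<phi>n: "bij_betw \<phi>n (- ?Yp) UNIV" "\<And>w. \<phi>n (shift n w) = shift 1 (\<phi>n w)"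
    using compl_half_equivariant_bij[OF assms(2)] by blast
  obtain \<psi>n :: "bs_point \<Rightarrow> int \<times> nat" where \<psi>n: "bij_betw \<psi>n ?Yp UNIV" "\<And>w. w \<in> ?Yp \<Longrightarrow> \<psi>n (shift n w) = shift 1 (\<psi>n w)"
    using half_equivariant_bij[OF assms(2)] by blast
  define T where "T w = (if w \<in> ?Ym then inv_into (- ?Yp) \<phi>n (\<psi>m w) else inv_into ?Yp \<psi>n (\<phi>m w))" for w
  have inv_shift: "inv_into D \<theta> (shift 1 c) = shift n (inv_into D \<theta> c)"
    if \<theta>: "bij_betw \<theta> D UNIV" "\<And>w. w \<in> D \<Longrightarrow> \<theta> (shift n w) = shift 1 (\<theta> w)"
      and D: "\<And>w. w \<in> D \<Longrightarrow> shift n w \<in> D" for D and \<theta> :: "bs_point \<Rightarrow> int \<times> nat" and c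
  proof -
    have c: "inv_into D \<theta> c \<in> D" using bij_betw_imp_surj_on[OF \<theta>(1)] by (intro inv_into_into) simp
    have "\<theta> (shift n (inv_into D \<theta> c)) = shift 1 c"
      using \<theta>(2)[OF c] bij_betw_inv_into_right[OF \<theta>(1), of c] by simp
    then show ?thesis using bij_betw_inv_into_left[OF \<theta>(1) D[OF c]] by simp
  qed
  have T1: "bij_betw T ?Ym (- ?Yp)"
    using bij_betw_trans[OF \<psi>m(1) bij_betw_inv_into[OF \<phi>n(1)]]
    by (rule bij_betw_cong[THEN iffD1, rotated]) (simp add: T_def)
  have T2: "bij_betw T (- ?Ym) ?Yp"
    using bij_betw_trans[OF \<phi>m(1) bij_betw_inv_into[OF \<psi>n(1)]]
    by (rule bij_betw_cong[THEN iffD1, rotated]) (simp add: T_def)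
  have T_iff: "T w \<in> ?Yp \<longleftrightarrow> w \<notin> ?Ym" for w
    using bij_betwE[OF T1] bij_betwE[OF T2] by auto
  have "bij T"
    using bij_betw_combine[OF T1 T2] by (simp add: Int_commute)
  have T_shift: "T (shift m w) = shift n (T w)" for w
  proof (cases "w \<in> ?Ym")
    case True
    then show ?thesis
      using \<psi>m(2)[OF True] inv_shift[OF \<phi>n(1)] \<phi>n(2) by (simp add: T_def shift_half_iff)
  next
    case False
    then show ?thesis
      using \<phi>m(2)[of w] inv_shift[OF \<psi>n(1)] \<psi>n(2) by (simp add: T_def shift_half_iff)
  qed
  have "pingpong shift T m n ?Yp ?Ym {(z, (c, j)). c = None}"
  proof
    show "n dvd k" if "w \<in> ?Yp" "shift k w \<in> ?Yp" for w k
      using that by (auto simp: half_def shift_def dvd_add_right_iff)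
    show "m dvd k" if "w \<in> ?Ym" "shift k w \<in> ?Ym" for w k
      using that by (auto simp: half_def shift_def dvd_add_right_iff)
  qed (use \<open>bij T\<close> T_iff T_shift in \<open>auto simp: half_def shift_def prod_eq_iff\<close>)
  then show ?thesis by (rule that)
qed

section \<open>Translations of trees\<close>

text \<open>
  A tree described by its distance function. Distinct points at distance 0 stand for the same vertex, which
  allows words to be used in place of cosets. A vertex other than \<open>v\<close> has exactly one neighbour closer to \<open>v\<close>,
  and all other neighbours are farther away.
\<close>

locale pseudo_tree =
  fixes d :: "'v \<Rightarrow> 'v \<Rightarrow> nat"
  assumes d_self [simp]: "d u u = 0"
    and d_sym: "d u v = d v u"
    and d_triangle: "d u w \<le> d u v + d v w"
    and closer_exists: "d u v = Suc l \<Longrightarrow> \<exists>p. d u p = 1 \<and> d p v = l"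
    and closer_unique: "d u p = 1 \<Longrightarrow> d u q = 1 \<Longrightarrow> d u v = Suc (d p v) \<Longrightarrow> d u v = Suc (d q v) \<Longrightarrow> d p q = 0"
    and d_neighbour: "d u p = 1 \<Longrightarrow> d p v \<noteq> d u v"
begin

lemma d_cong: "d u u' = 0 \<Longrightarrow> d u v = d u' v"
  using d_triangle[of u v u'] d_triangle[of u' v u] d_sym[of u u'] by simp

lemma d_cong2: "d v v' = 0 \<Longrightarrow> d u v = d u v'"
  using d_cong[of v v' u] d_sym by metis

lemma neighbour_cases: "d u p = 1 \<Longrightarrow> d p v = Suc (d u v) \<or> d u v = Suc (d p v)"
  using d_triangle[of u v p] d_triangle[of p v u] d_sym[of u p] d_neighbour[of u p v] by linarith

text \<open>
  Two geodesics that do not start along a common edge at \<open>v\<close> join to a geodesic. The induction moves \<open>v\<close> towards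
  \<open>w\<close>: from the next vertex, the only neighbour closer to \<open>u\<close> is \<open>v\<close>, which is farther from \<open>w\<close>.
\<close>

lemma d_concat:
  assumes "\<And>p. d v p = 1 \<Longrightarrow> d v u = Suc (d p u) \<Longrightarrow> d v w = Suc (d p w) \<Longrightarrow> False"
  shows "d u w = d u v + d v w"
  using assms
proof (induction "d v w" arbitrary: v)
  case 0
  then show ?case using d_cong2[of v w u] by simp
next
  case (Suc l)
  obtain q where q: "d v q = 1" "d q w = l" using closer_exists[OF Suc.hyps(2)[symmetric]] by blast
  have qu: "d q u = Suc (d v u)"
    using neighbour_cases[OF q(1), of u] Suc.prems[OF q(1)] Suc.hyps(2) q(2) by auto
  have "d u w = d u q + d q w"
  proof (rule Suc.hyps(1))
    show "l = d q w" using q by simp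
    fix p assume p: "d q p = 1" "d q u = Suc (d p u)" "d q w = Suc (d p w)"
    have "d p v = 0" by (rule closer_unique[of q p v u]) (use p qu q d_sym[of v q] in simp_all)
    then have "d p w = d v w" by (rule d_cong)
    then show False using p q Suc.hyps(2) by simp
  qed
  then show ?case using qu q Suc.hyps(2) d_sym[of u q] d_sym[of u v] by simp
qed

lemma geodesic_point_unique:
  assumes "d u p + d p v = d u v" "d u q + d q v = d u v" "d u p = d u q"
  shows "d p q = 0"
  using assms
proof (induction "d u p" arbitrary: u)
  case 0
  then show ?case using d_triangle[of p q u] d_sym[of u p] by simp
next
  case (Suc l)
  obtain p' where p': "d u p' = 1" "d p' p = l" using closer_exists[OF Suc.hyps(2)[symmetric]] by blast
  obtain q' where q': "d u q' = 1" "d q' q = l" using closer_exists Suc.hyps(2) Suc.prems(3) by metis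
  have pv: "d p' v = l + d p v" "d u v = Suc (d p' v)"
    using d_triangle[of p' v p] d_triangle[of u v p'] p' Suc.hyps(2) Suc.prems by simp_all
  have qv: "d q' v = l + d q v" "d u v = Suc (d q' v)"
    using d_triangle[of q' v q] d_triangle[of u v q'] q' Suc.hyps(2) Suc.prems by simp_all
  have 0: "d p' q' = 0" by (rule closer_unique[OF p'(1) q'(1) pv(2) qv(2)])
  show ?case
  proof (rule Suc.hyps(1))
    show "l = d p' p" using p' by simp
    show "d p' p + d p v = d p' v" using pv p' by simp
    show "d p' q + d q v = d p' v" using qv q' d_cong[OF 0, of q] d_cong[OF 0, of v] by simp
    show "d p' p = d p' q" using p' q' d_cong[OF 0, of q] by simp
  qed
qed

end

text \<open>
  An isometry \<open>f\<close> without fixed vertices and without inverted edges; \<open>g\<close> is its inverse up to points at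
  distance 0.
\<close>

locale tree_translation = pseudo_tree d for d :: "'v \<Rightarrow> 'v \<Rightarrow> nat" +
  fixes f g :: "'v \<Rightarrow> 'v"
  assumes f_isometry: "d (f u) (f v) = d u v"
    and f_g: "d (f u) v = d u (g v)"
    and no_fixed: "d u (f u) > 0"
    and no_inversion: "d u (f u) = 1 \<Longrightarrow> d u (f (f u)) \<noteq> 0"
begin

definition displ :: nat where
  "displ = (LEAST l. \<exists>u. d u (f u) = l)"

definition axis :: "'v set" where
  "axis = {u. d u (f u) = displ}"

lemma displ_le: "displ \<le> d u (f u)"
  unfolding displ_def by (rule Least_le) blast

lemma axis_ne: "\<exists>u. u \<in> axis"
  unfolding axis_def displ_def mem_Collect_eq by (rule LeastI_ex) blast

lemma displ_pos: "displ > 0"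
proof -
  obtain u where "u \<in> axis" using axis_ne by blast
  then show ?thesis using no_fixed[of u] by (simp add: axis_def)
qed

lemma axisI: "d u (f u) \<le> displ \<Longrightarrow> u \<in> axis"
  using displ_le[of u] by (simp add: axis_def)

lemma fpow_isometry: "d ((f ^^ k) u) ((f ^^ k) v) = d u v"
  by (induction k) (auto simp: f_isometry)

lemma fpow_gpow: "d ((f ^^ k) u) v = d u ((g ^^ k) v)"
  by (induction k arbitrary: u v) (auto simp: f_g funpow_swap1)

text \<open>
  If the geodesics from \<open>f u\<close> back to \<open>u\<close> and on to \<open>f (f u)\<close> shared their first edge, with end \<open>p\<close>, then the
  geodesic from \<open>u\<close> to \<open>f u\<close> would have \<open>g p\<close> as its second and \<open>p\<close> as its last but one vertex, and \<open>f\<close> would move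
  \<open>g p\<close> to \<open>p\<close>, by two edges less than \<open>u\<close>. If that geodesic is a single edge, then \<open>f\<close> inverts it.
\<close>

lemma axis_step:
  assumes "u \<in> axis"
  shows "d u (f (f u)) = 2 * displ"
proof -
  have l: "d u (f u) = displ" using assms by (simp add: axis_def)
  have "d u (f (f u)) = d u (f u) + d (f u) (f (f u))"
  proof (rule d_concat)
    fix p assume p: "d (f u) p = 1" "d (f u) u = Suc (d p u)" "d (f u) (f (f u)) = Suc (d p (f (f u)))"
    have pu: "Suc (d p u) = displ" using p l d_sym[of u] by simp
    have gp: "d u (g p) = 1" "Suc (d (g p) (f u)) = displ"
      using p f_g[of u p] f_isometry[of u "f u"] l f_g[of "f u" p] d_sym by (metis, metis)
    have fg: "d (f (g p)) p = 0" using f_g[of "g p" p] by simp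
    show False
    proof (cases "d (g p) (f u)")
      case 0
      then have "displ = 1" using gp by simp
      then have "d p u = 0" "d p (f (f u)) = 0" using pu p(3) l f_isometry[of u "f u"] by simp_all
      then have "d u (f (f u)) = 0" using d_cong[of p u] by metis
      then show False using no_inversion[of u] l \<open>displ = 1\<close> by simp
    next
      case (Suc i)
      then have "d (f u) (g p) = Suc i" using d_sym by metis
      then obtain q where q: "d (f u) q = 1" "d q (g p) = i" using closer_exists by blast
      have le: "d q u \<le> Suc i" using d_triangle[of q u "g p"] q gp d_sym[of u "g p"] by simp
      have fuu: "d (f u) u = Suc (Suc i)" using gp Suc l d_sym[of u "f u"] by simp
      have qu: "d (f u) u = Suc (d q u)"
        using neighbour_cases[OF q(1), of u] le fuu by simp
      have "d p q = 0" by (rule closer_unique[OF p(1) q(1) p(2) qu])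
      then have "d p (g p) = i" using d_cong q by metis
      then have "d (g p) (f (g p)) = i" using d_cong2[OF fg] d_sym by metis
      then show False using displ_le[of "g p"] gp Suc by simp
    qed
  qed
  then show ?thesis using l f_isometry[of u "f u"] by simp
qed

lemma axis_pow:
  assumes "u \<in> axis"
  shows "d u ((f ^^ k) u) = k * displ"
proof (induction k)
  case (Suc k)
  have l: "d u (f u) = displ" using assms by (simp add: axis_def)
  show ?case
  proof (cases k)
    case 0
    then show ?thesis using l by simp
  next
    case (Suc j)
    define v where "v = (f ^^ j) u"
    have fv: "(f ^^ k) u = f v" "(f ^^ Suc k) u = f (f v)" by (simp_all add: v_def Suc)
    have d1: "d v (f v) = displ" "d (f v) (f (f v)) = displ" "d v (f (f v)) = 2 * displ"
      using fpow_isometry[of j u "f u"] fpow_isometry[of j u "f (f u)"] axis_step[OF assms] l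
        f_isometry[of v "f v"]
      by (simp_all add: v_def funpow_swap1)
    have uk: "d u (f v) = Suc j * displ" using Suc.IH fv Suc by simp
    have uv: "d u v \<le> j * displ"
    proof -
      have "d u ((f ^^ i) u) \<le> i * displ" for i
      proof (induction i)
        case (Suc i)
        show ?case using d_triangle[of u "(f ^^ Suc i) u" "(f ^^ i) u"] Suc
            fpow_isometry[of i u "f u"] l by (simp add: funpow_swap1)
      qed simp
      then show ?thesis by (simp add: v_def)
    qed
    have "d u (f (f v)) = d u (f v) + d (f v) (f (f v))"
    proof (rule d_concat)
      fix p assume p: "d (f v) p = 1" "d (f v) u = Suc (d p u)" "d (f v) (f (f v)) = Suc (d p (f (f v)))"
      obtain i where i: "displ = Suc i" using displ_pos by (cases displ) auto
      obtain q where q: "d (f v) q = 1" "d q v = i" using closer_exists[of "f v" v i] d1 i d_sym by metis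
      have "d q u \<le> i + j * displ" using d_triangle[of q u v] q uv d_sym[of u v] by simp
      then have "d (f v) u = Suc (d q u)"
        using neighbour_cases[OF q(1), of u] uk i d_sym[of u "f v"] by simp
      then have "d p q = 0" using closer_unique[OF p(1) q(1) p(2)] by blast
      then have "d p v = i" using d_cong q by metis
      then show False using d_triangle[of v "f (f v)" p] d1 p(3) i d_sym[of v p] by simp
    qed
    then show ?thesis using uk d1 fv Suc by simp
  qed
qed simp

text \<open>
  \<open>D\<close> is the distance from \<open>v\<close> to the axis. With \<open>u\<close> the nearest point of the axis, the geodesic from \<open>v\<close> to
  \<open>f\<^sup>k v\<close> runs through \<open>u\<close> and \<open>f\<^sup>k u\<close>: if it cut a corner at either of them, a neighbour of \<open>u\<close> on the axis would be nearer
  to \<open>v\<close>.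
\<close>

lemma displacement_formula:
  "\<exists>D. (\<forall>k\<ge>1. d v ((f ^^ k) v) = 2 * D + k * displ) \<and> (D = 0 \<longrightarrow> v \<in> axis)"
proof -
  define D where "D = (LEAST D. \<exists>u\<in>axis. d v u = D)"
  have "\<exists>u\<in>axis. d v u = D" unfolding D_def by (rule LeastI_ex) (use axis_ne in blast)
  then obtain u where u: "u \<in> axis" "d v u = D" by blast
  have D_le: "D \<le> d v u'" if "u' \<in> axis" for u' unfolding D_def by (rule Least_le) (use that in blast)
  have l: "d u (f u) = displ" using u by (simp add: axis_def)
  obtain i where i: "displ = Suc i" using displ_pos by (cases displ) auto
  have vk: "d v ((f ^^ k) u) = D + k * displ" for k
  proof (cases k)
    case (Suc j)
    have "d v ((f ^^ k) u) = d v u + d u ((f ^^ k) u)"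
    proof (rule d_concat)
      fix p assume p: "d u p = 1" "d u v = Suc (d p v)" "d u ((f ^^ k) u) = Suc (d p ((f ^^ k) u))"
      obtain q where q: "d u q = 1" "d q (f u) = i" using closer_exists[of u "f u" i] l i by metis
      have "d (f u) ((f ^^ k) u) = j * displ"
        using f_isometry[of u "(f ^^ j) u"] axis_pow[OF u(1), of j] by (simp add: Suc)
      then have "d q ((f ^^ k) u) \<le> i + j * displ" using d_triangle[of q "(f ^^ k) u" "f u"] q by simp
      then have "d u ((f ^^ k) u) = Suc (d q ((f ^^ k) u))"
        using neighbour_cases[OF q(1), of "(f ^^ k) u"] axis_pow[OF u(1), of k] i Suc by simp
      then have "d p q = 0" using closer_unique[OF p(1) q(1) p(3)] by blast
      then have "d q v = d p v" using d_cong by metis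
      moreover have "q \<in> axis"
        using d_triangle[of q "f q" "f u"] f_isometry[of u q] q i by (intro axisI) simp
      ultimately show False using D_le[of q] p(2) u(2) d_sym[of v] by simp
    qed
    then show ?thesis using u axis_pow[OF u(1)] by simp
  qed (simp add: u)
  have "d v ((f ^^ k) v) = 2 * D + k * displ" if k1: "k \<ge> 1" for k
  proof -
    obtain j where j: "k = Suc j" using k1 by (auto simp: Suc_le_eq gr0_conv_Suc)
    define c where "c = (f ^^ k) u"
    define b where "b = (f ^^ j) u"
    have c_fb: "c = f b" by (simp add: c_def b_def j)
    have bc: "d b c = displ" using fpow_isometry[of j u "f u"] l by (simp add: c_fb b_def funpow_swap1)
    have cfkv: "d c ((f ^^ k) v) = D" unfolding c_def using fpow_isometry[of k u v] u(2) d_sym by metis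
    have "d v ((f ^^ k) v) = d v c + d c ((f ^^ k) v)"
    proof (rule d_concat)
      fix p assume p: "d c p = 1" "d c v = Suc (d p v)" "d c ((f ^^ k) v) = Suc (d p ((f ^^ k) v))"
      obtain q where q: "d c q = 1" "d q b = i" using closer_exists[of c b i] bc i d_sym by metis
      have "d q v \<le> i + (D + j * displ)"
        using d_triangle[of q v b] q vk[of j] d_sym[of v b] by (simp add: b_def)
      then have "d c v = Suc (d q v)"
        using neighbour_cases[OF q(1), of v] vk[of k] i j d_sym[of v c] by (simp add: c_def)
      then have "d p q = 0" using closer_unique[OF p(1) q(1) p(2)] by blast
      then have qD: "Suc (d q ((f ^^ k) v)) = D" using d_cong[of p q] p(3) cfkv by simp
      have q_axis: "d q (f q) \<le> displ"
        using d_triangle[of q "f q" c] q f_isometry[of b q] c_fb d_sym[of c q] d_sym[of b q] i by simp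
      define q' where "q' = (g ^^ k) q"
      have fq': "d ((f ^^ k) q') q = 0" unfolding q'_def fpow_gpow by simp
      have "d q' (f q') = d ((f ^^ k) q') (f ((f ^^ k) q'))"
        using fpow_isometry[of k q' "f q'"] by (simp add: funpow_swap1)
      also have "\<dots> = d q (f q)"
        using d_cong[OF fq'] d_cong2[of "f ((f ^^ k) q')" "f q"] f_isometry fq' by metis
      finally have "q' \<in> axis" using q_axis by (intro axisI) simp
      moreover have "d v q' = d ((f ^^ k) v) q" unfolding q'_def fpow_gpow ..
      ultimately show False using D_le[of q'] qD d_sym[of q] by simp
    qed
    then show ?thesis using vk[of k] cfkv by (simp add: c_def)
  qed
  moreover have "v \<in> axis" if "D = 0"
    using calculation[of 1] that by (simp add: axis_def)
  ultimately show ?thesis by blast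
qed

text \<open>
  The isometry \<open>h\<close> conjugates \<open>f\<^sup>k\<close> to \<open>f\<^bsup>k'\<^esup>\<close>. For \<open>h v\<close> on the axis the displacements of \<open>v\<close> under \<open>f\<^sup>k\<close> and
  \<open>f\<^bsup>2k\<^esup>\<close> are \<open>k'\<close> and \<open>2k'\<close> times the minimal displacement, while both contain the same constant \<open>2D\<close>; so \<open>D = 0\<close>.
\<close>

lemma exponents_eq:
  assumes "\<And>u v. d (h u) (h v) = d u v" "k \<ge> 1" "k' \<ge> 1"
    and "\<And>u. d (h ((f ^^ k) u)) ((f ^^ k') (h u)) = 0"
    and "\<And>u. d (h ((f ^^ (2 * k)) u)) ((f ^^ (2 * k')) (h u)) = 0"
    and "\<And>u. \<exists>v. d (h v) u = 0"
  shows "k = k'"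
proof -
  obtain u where u: "u \<in> axis" using axis_ne by blast
  obtain v where v: "d (h v) u = 0" using assms(6) by blast
  obtain D where D: "\<And>j. j \<ge> 1 \<Longrightarrow> d v ((f ^^ j) v) = 2 * D + j * displ"
    using displacement_formula[of v] by blast
  have hu: "d (h v) ((f ^^ j) (h v)) = j * displ" for j
  proof -
    have "d (h v) ((f ^^ j) (h v)) = d u ((f ^^ j) u)"
      using d_cong[OF v] d_cong2[of "(f ^^ j) (h v)" "(f ^^ j) u"] fpow_isometry[of j "h v" u] v by metis
    then show ?thesis using axis_pow[OF u] by simp
  qed
  have "d v ((f ^^ k) v) = d (h v) ((f ^^ k') (h v))"
    using assms(1)[of v "(f ^^ k) v"] d_cong2[OF assms(4)] by metis
  then have 1: "2 * D + k * displ = k' * displ" using D[OF assms(2)] hu by simp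
  have "d v ((f ^^ (2 * k)) v) = d (h v) ((f ^^ (2 * k')) (h v))"
    using assms(1)[of v "(f ^^ (2 * k)) v"] d_cong2[OF assms(5)] by metis
  then have "2 * D + (2 * k) * displ = (2 * k') * displ" using D[of "2 * k"] hu assms(2) by simp
  then have "D = 0" using 1 by simp
  then show ?thesis using 1 displ_pos by simp
qed

text \<open>
  Both \<open>f\<close> and its conjugate by \<open>h\<close> have the same \<open>k\<close>-th power, hence the same axis, and they translate it by
  the same amount. Concretely, \<open>f u\<close> and its counterpart lie at the same distance from \<open>u\<close> on the geodesic from \<open>u\<close> to
  \<open>f\<^sup>k u\<close>.
\<close>

lemma commuting_power_conj:
  assumes h: "\<And>u v. d (h u) (h v) = d u v" and k: "k \<ge> 1"
    and comm: "\<And>u. d (h ((f ^^ k) u)) ((f ^^ k) (h u)) = 0"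
    and u: "u \<in> axis" and v: "d (h v) u = 0"
  shows "d (h (f v)) (f u) = 0"
proof -
  obtain D where D: "\<And>j. j \<ge> 1 \<Longrightarrow> d v ((f ^^ j) v) = 2 * D + j * displ" "D = 0 \<Longrightarrow> v \<in> axis"
    using displacement_formula[of v] by blast
  have fk: "d (h ((f ^^ k) v)) ((f ^^ k) u) = 0"
    using d_cong[OF comm] fpow_isometry[of k "h v" u] v by metis
  have "d v ((f ^^ k) v) = d u ((f ^^ k) u)"
    using h[of v "(f ^^ k) v"] d_cong2[OF fk] d_cong[OF v] by metis
  then have "2 * D + k * displ = k * displ" using D(1)[OF k] axis_pow[OF u] by simp
  then have va: "v \<in> axis" using D(2) by simp
  obtain j where j: "k = Suc j" using k by (auto simp: Suc_le_eq gr0_conv_Suc)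
  have tail: "d (f v) ((f ^^ k) v) = j * displ" if "v \<in> axis" for v
    using f_isometry[of v "(f ^^ j) v"] axis_pow[OF that, of j] by (simp add: j)
  show ?thesis
  proof (rule geodesic_point_unique[of u _ "(f ^^ k) u"])
    have 1: "d u (h (f v)) = displ" using d_cong[OF v] h[of v "f v"] va by (simp add: axis_def)
    have 2: "d (h (f v)) ((f ^^ k) u) = j * displ"
      using d_cong2[OF fk] h[of "f v" "(f ^^ k) v"] tail[OF va] by metis
    show "d u (h (f v)) + d (h (f v)) ((f ^^ k) u) = d u ((f ^^ k) u)"
      unfolding 1 2 axis_pow[OF u] by (simp add: j)
    show "d u (f u) + d (f u) ((f ^^ k) u) = d u ((f ^^ k) u)"
      using u unfolding tail[OF u] axis_pow[OF u] by (simp add: j axis_def)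
    show "d u (h (f v)) = d u (f u)" using 1 u by (simp add: axis_def)
  qed
qed

end

section \<open>The Bass-Serre tree on words\<close>

context pingpong
begin

text \<open>
  A word \<open>w\<close> stands for the vertex \<open>w\<langle>a\<rangle>\<close> of the Bass-Serre tree.
\<close>

definition dist :: "bs_gen word \<Rightarrow> bs_gen word \<Rightarrow> nat" where
  "dist u v = tlen m n (winv u @ v)"

lemma tlen_act: "act u = act v \<Longrightarrow> tlen m n u = tlen m n v"
  using act_eq_iff_bs_eq tlen_cong by blast

lemma dist_eqI: "act (winv u @ v) = act (winv u' @ v') \<Longrightarrow> dist u v = dist u' v'"
  unfolding dist_def by (rule tlen_act)

lemma tlen_0_act_iff: "tlen m n w = 0 \<longleftrightarrow> (\<exists>k. act w = A k)"
  unfolding tlen_0_iff by (simp flip: act_eq_iff_bs_eq)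

lemma dist_0_iff: "dist u v = 0 \<longleftrightarrow> (\<exists>k. act (winv u @ v) = A k)"
  by (simp add: dist_def tlen_0_act_iff)

lemma dist_act_eq: assumes "act u = act v" shows "dist u v = 0"
proof -
  have "act (winv u @ v) = A 0" by (rule ext) (simp add: word_act_append flip: assms)
  then show ?thesis unfolding dist_0_iff by blast
qed

lemma tlen_apow_append: "tlen m n (apow j @ w) = tlen m n w"
proof -
  have "tlen m n (apow j @ w) \<le> tlen m n w" for j w
    using tlen_append[of m n "apow j" w] by simp
  from this[of j w] this[of "- j" "apow j @ w"]
  show ?thesis using tlen_act[of "apow (- j) @ apow j @ w" w] by (simp add: word_act_append fun_eq_iff)
qed

lemma dist_triangle: "dist u w \<le> dist u v + dist v w"
proof -
  have "dist u w = tlen m n ((winv u @ v) @ winv v @ w)"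
    unfolding dist_def by (rule tlen_act) (simp add: word_act_append fun_eq_iff)
  then show ?thesis using tlen_append unfolding dist_def by metis
qed

lemma dist_sym: "dist u v = dist v u"
  using tlen_winv[of m n "winv u @ v"] by (simp add: dist_def)

lemma tlen_1E:
  assumes "tlen m n w = 1"
  obtains k e j where "bs_eq m n w (apow k @ tletter e @ apow j)"
proof -
  obtain k e w' where *: "bs_eq m n w (apow k @ tletter e @ w')" "tlen m n w' = 0"
    using tlen_SucE[of m n w 0] assms by auto
  then obtain j where "bs_eq m n w' (apow j)" using tlen_0_iff by blast
  then have "bs_eq m n (apow k @ tletter e @ w') (apow k @ tletter e @ apow j)"
    by (intro bs_eq_left[of _ _ "tletter e @ w'"] bs_eq_left[of _ _ w'])
  then show ?thesis by (rule that[OF bs_eq_trans[OF *(1)]])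
qed

text \<open>
  The half-tree that contains the target determines the edge by which a geodesic leaves its origin; this is
  what makes the closer neighbour unique.
\<close>

lemma location_neighbour:
  assumes p: "dist u p = 1" "dist u v = Suc (dist p v)" and b: "b \<in> B"
  obtains k e j where "act (winv u @ p) = A k \<circ> t_act e \<circ> A j" "A (- k) (act (winv u @ v) b) \<in> Y e"
proof -
  obtain k e j where kej: "bs_eq m n (winv u @ p) (apow k @ tletter e @ apow j)"
    using tlen_1E p(1) unfolding dist_def by blast
  have act_up: "act (winv u @ p) = A k \<circ> t_act e \<circ> A j"
    using act_cong[OF kej] by (auto simp: word_act_append)
  have "act (winv u @ v) = act ((winv u @ p) @ (winv p @ v))"
    by (simp add: word_act_append fun_eq_iff)
  also have "\<dots> = act (apow k @ tletter e @ (apow j @ winv p @ v))"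
    unfolding word_act_append[of _ _ "winv u @ p"] act_up by (simp add: word_act_append comp_assoc)
  finally have "bs_eq m n (winv u @ v) (apow k @ tletter e @ (apow j @ winv p @ v))"
    by (simp only: act_eq_iff_bs_eq)
  from location[OF _ this _ b] have "A (- k) (act (winv u @ v) b) \<in> Y e"
    using p(2) by (simp add: tlen_apow_append dist_def)
  then show ?thesis using that act_up by blast
qed

sublocale tree: pseudo_tree dist
proof
  show "dist u u = 0" for u by (rule dist_act_eq) simp
  show "dist u v = dist v u" for u v by (rule dist_sym)
  show "dist u w \<le> dist u v + dist v w" for u v w by (rule dist_triangle)
next
  fix u v l
  assume uv: "dist u v = Suc l"
  then obtain k e w' where w': "bs_eq m n (winv u @ v) (apow k @ tletter e @ w')" "tlen m n w' = l"
    using tlen_SucE unfolding dist_def by blast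
  let ?p = "u @ apow k @ tletter e"
  have "tlen m n (winv ?p @ v) = tlen m n w'"
    using act_cong[OF w'(1)] by (intro tlen_act) (simp add: word_act_append fun_eq_iff)
  then have pv: "dist ?p v = l" using w'(2) by (simp add: dist_def)
  have "dist u ?p = tlen m n (apow k @ tletter e)"
    unfolding dist_def by (rule tlen_act) (simp add: word_act_append fun_eq_iff)
  then have "dist u ?p \<le> 1"
    using tlen_apow_append tlen_le[OF bs_eq_refl, of m n "tletter e"] by simp
  then have "dist u ?p = 1" using dist_triangle[of u v ?p] uv pv by simp
  then show "\<exists>p. dist u p = 1 \<and> dist p v = l" using pv by blast
next
  fix u p q v
  assume p: "dist u p = 1" "dist u v = Suc (dist p v)" and q: "dist u q = 1" "dist u v = Suc (dist q v)"
  obtain b where b: "b \<in> B" using B_ne by blast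
  obtain k e j where 1: "act (winv u @ p) = A k \<circ> t_act e \<circ> A j" "A (- k) (act (winv u @ v) b) \<in> Y e"
    using location_neighbour[OF p b] by blast
  obtain k' e' j' where 2: "act (winv u @ q) = A k' \<circ> t_act e' \<circ> A j'" "A (- k') (act (winv u @ v) b) \<in> Y e'"
    using location_neighbour[OF q b] by blast
  let ?z = "act (winv u @ v) b"
  have shift: "A (- k') ?z = A (k - k') (A (- k) ?z)" using A_add[of "k - k'" "- k"] by simp
  have e: "e' = e" using Y_disjoint[OF 1(2), of "k - k'"] 2(2) shift by (cases e; cases e') simp_all
  have "edge_exp m n e dvd k - k'" using Y_free[OF 1(2), of "k - k'"] 2(2) shift e by simp
  then obtain i where i: "k' = k + edge_exp m n e * i" by (metis dvd_def diff_eq_eq add.commute dvd_diff_commute)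
  have eqs: "act p w = act u (A k (t_act e (A j w)))" "act q w = act u (A k' (t_act e (A j' w)))" for w
    using fun_cong[OF 1(1), of w] fun_cong[OF 2(1), of w] e
    by (simp_all add: word_act_append) (metis act_act_winv)+
  have "act q w = act p (A (j' + edge_exp m n (\<not> e) * i - j) w)" for w
  proof -
    have "A (j' + edge_exp m n (\<not> e) * i - j) w = A (- j) (A (edge_exp m n (\<not> e) * i) (A j' w))"
      by (simp flip: A_add add: algebra_simps)
    then show ?thesis unfolding eqs i A_add[of k] by (simp add: t_act_A)
  qed
  then have "act (winv p @ q) = A (j' + edge_exp m n (\<not> e) * i - j)"
    by (simp add: word_act_append fun_eq_iff)
  then show "dist p q = 0" unfolding dist_0_iff by blast
next
  fix u p v
  assume "dist u p = 1"
  then have "odd (height p - height u)" using even_tlen_height[of m n "winv u @ p"] by (simp add: dist_def)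
  moreover have "even (int (dist u v) + (height v - height u))" "even (int (dist p v) + (height v - height p))"
    using even_tlen_height[of m n "winv u @ v"] even_tlen_height[of m n "winv p @ v"] by (simp_all add: dist_def)
  ultimately show "dist p v \<noteq> dist u v" by presburger
qed

lemma dist_append [simp]: "dist (x @ u) (x @ v) = dist u v"
  by (rule dist_eqI) (simp add: word_act_append fun_eq_iff)

lemma translation:
  assumes "\<And>u. dist u (x @ u) > 0"
  shows "tree_translation dist ((@) x) ((@) (winv x))"
proof
  show "dist (x @ u) v = dist u (winv x @ v)" for u v
    by (rule dist_eqI) (simp add: word_act_append fun_eq_iff)
  fix u
  assume "dist u (x @ u) = 1"
  then have "odd (height x)" using even_tlen_height[of m n "winv u @ x @ u"] by (simp add: dist_def)
  moreover have "height x = 0" if "dist u (x @ x @ u) = 0"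
  proof -
    obtain k where "act (winv u @ x @ x @ u) = act (apow k)" using \<open>dist u (x @ x @ u) = 0\<close> dist_0_iff by auto
    then have "bs_eq m n (winv u @ x @ x @ u) (apow k)" by (simp only: act_eq_iff_bs_eq)
    then show ?thesis using height_cong by fastforce
  qed
  ultimately show "dist u (x @ x @ u) \<noteq> 0" by (metis even_zero)
qed (use assms in auto)

text \<open>
  The squares make signs disappear: \<open>y\<^sup>2\<close> conjugates \<open>x\<^bsup>r*r\<^esup>\<close> to \<open>x\<^bsup>s*s\<^esup>\<close>, both positive powers. If \<open>x\<close> fixes no
  vertex, it follows that \<open>r*r = s*s\<close> and that \<open>h = y\<^sup>2\<close> and \<open>h = y\<^sup>4\<close> commute with \<open>x\<^bsup>r*r\<^esup>\<close>. For such \<open>h\<close>, the word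
  \<open>x\<^sup>-\<^sup>1 h x h\<^sup>-\<^sup>1\<close> fixes every vertex of the axis of \<open>x\<close>, and vertex stabilisers are cyclic.
\<close>

theorem elliptic_or_commuting:
  fixes x y :: "bs_gen word" and r s :: int
  defines "w2 \<equiv> winv x @ y @ y @ x @ winv y @ winv y"
    and "w4 \<equiv> winv x @ y @ y @ y @ y @ x @ winv y @ winv y @ winv y @ winv y"
  assumes rel: "\<And>w. act y (act (wpow x r) w) = act (wpow x s) (act y w)"
    and rs: "r \<noteq> 0" "s \<noteq> 0"
  shows "(\<exists>u k. act (winv u @ x @ u) = A k) \<or> \<bar>r\<bar> = \<bar>s\<bar> \<and> act (w2 @ w4) = act (w4 @ w2)"
proof (cases "\<exists>u. dist u (x @ u) = 0")
  case True
  then show ?thesis using dist_0_iff by blast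
next
  case False
  interpret X: tree_translation dist "(@) x" "(@) (winv x)"
    using False by (intro translation) simp
  interpret D: bs_action "\<lambda>k. act (wpow x k)" "act y" r s by (rule derived_action[OF rel])
  have pos: "nat (r * r) \<ge> 1" "nat (s * s) \<ge> 1" 
    using rs by (auto simp: Suc_le_eq zero_less_mult_iff linorder_neq_iff)
  have ints: "int (nat (r * r)) = r * r" "int (nat (s * s)) = s * s" by simp_all
  have comm1: "dist (y @ y @ (((@) x ^^ nat (r * r)) u)) (((@) x ^^ nat (s * s)) (y @ y @ u)) = 0" for u
    using D.TT_A[of 1] by (intro dist_act_eq) (simp add: fun_eq_iff act_funpow_append word_act_append)
  have comm2: "dist (y @ y @ (((@) x ^^ (2 * nat (r * r))) u)) (((@) x ^^ (2 * nat (s * s))) (y @ y @ u)) = 0" for u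
    using D.TT_A[of 2] by (intro dist_act_eq) (simp add: fun_eq_iff act_funpow_append word_act_append mult.commute)
  have onto: "dist (h @ winv h @ u) u = 0" for h u
    by (intro dist_act_eq) (simp add: fun_eq_iff word_act_append)
  have "nat (r * r) = nat (s * s)"
  proof (rule X.exponents_eq[where h = "\<lambda>u. y @ y @ u"])
    show "\<exists>v. dist (y @ y @ v) u = 0" for u using onto[of "y @ y" u] by auto
  qed (use pos comm1 comm2 in auto)
  then have sq: "r * r = s * s" using ints by metis
  then have abs: "\<bar>r\<bar> = \<bar>s\<bar>" by (metis abs_eq_iff square_eq_iff)
  obtain u where u: "u \<in> X.axis" using X.axis_ne by blast
  have fix_u: "\<exists>k. act (winv u @ (winv x @ h @ x @ winv h) @ u) = A k"
    if "\<And>w. act h (act (wpow x (r * r)) w) = act (wpow x (r * r)) (act h w)" for h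
  proof -
    have "dist (h @ x @ winv h @ u) (x @ u) = 0"
    proof (rule X.commuting_power_conj[where h = "(@) h" and k = "nat (r * r)"])
      show "dist (h @ ((@) x ^^ nat (r * r)) u) (((@) x ^^ nat (r * r)) (h @ u)) = 0" for u
        using that by (intro dist_act_eq) (simp add: fun_eq_iff act_funpow_append word_act_append)
    qed (use pos u onto in auto)
    then have "dist (x @ u) (h @ x @ winv h @ u) = 0" using dist_sym by metis
    then show ?thesis unfolding dist_0_iff by (simp add: word_act_append comp_assoc)
  qed
  have TT: "act y (act y (act (wpow x (r * r)) w)) = act (wpow x (r * r)) (act y (act y w))" for w
    using D.TT_A[of 1 w] sq by simp
  obtain k2 where k2: "act (winv u @ w2 @ u) = A k2"
    using fix_u[of "y @ y"] TT by (auto simp: w2_def word_act_append)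
  obtain k4 where k4: "act (winv u @ w4 @ u) = A k4"
    using fix_u[of "y @ y @ y @ y"] TT by (auto simp: w4_def word_act_append)
  have c2: "act w2 w = act u (A k2 (act (winv u) w))" for w
  proof -
    have "act (winv u) (act w2 w) = A k2 (act (winv u) w)"
      using fun_cong[OF k2, of "act (winv u) w"] by (simp add: word_act_append)
    then show ?thesis by (metis act_act_winv)
  qed
  have c4: "act w4 w = act u (A k4 (act (winv u) w))" for w
  proof -
    have "act (winv u) (act w4 w) = A k4 (act (winv u) w)"
      using fun_cong[OF k4, of "act (winv u) w"] by (simp add: word_act_append)
    then show ?thesis by (metis act_act_winv)
  qed
  have "act (w2 @ w4) = act (w4 @ w2)"
    by (simp add: word_act_append fun_eq_iff c2 c4 A_comm[of k2 k4])
  then show ?thesis using abs by blast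
qed

end

section \<open>Embeddings as substitutions\<close>

primrec subst :: "bs_gen word \<Rightarrow> bs_gen word \<Rightarrow> bs_gen word \<Rightarrow> bs_gen word" where
  "subst x y [] = []"
| "subst x y (c # w) =
     (case c of (bs_gen.a, b) \<Rightarrow> if b then x else winv x | (bs_gen.t, b) \<Rightarrow> if b then y else winv y) @ subst x y w"

lemma subst_append: "subst x y (u @ v) = subst x y u @ subst x y v"
  by (induction u) auto

lemma subst_winv: "subst x y (winv w) = winv (subst x y w)"
proof (induction w)
  case (Cons c w)
  then show ?case by (cases c; cases "fst c") (auto simp: winv_Cons subst_append)
qed simp

lemma subst_apow: "subst x y (apow k) = wpow x k"
proof -
  have "subst x y (replicate i (bs_gen.a, b)) = concat (replicate i (if b then x else winv x))" for i b
    by (induction i) auto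
  then show ?thesis by (simp add: word_pow_def wpow_def)
qed

lemma subst_tletter_apow:
  "subst x y (tletter True @ apow i) = y @ wpow x i" "subst x y (apow j @ tletter True) = wpow x j @ y"
  by (simp_all add: subst_append subst_apow)

lemma (in bs_action) word_act_subst:
  "word_act (\<lambda>k. act (wpow x k)) (act y) w = act (subst x y w)"
proof (induction w)
  case (Cons c w)
  have "finv (act y) = act (winv y)"
    by (rule inv_equality) simp_all
  then have "letter_act (\<lambda>k. act (wpow x k)) (act y) c = act (subst x y [c])"
    by (cases c; cases "fst c") (auto simp: wpow_def letter_act.simps(2) simp del: letter_act_t)
  then show ?case using Cons subst_append[of x y "[c]" w] by (simp add: word_act_append)
qed simp

lemma subst_bs_eq_iff:
  assumes "\<And>w. bs_eq r s w [] \<longleftrightarrow> bs_eq m n (subst x y w) []"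
  shows "bs_eq r s u v \<longleftrightarrow> bs_eq m n (subst x y u) (subst x y v)"
  unfolding bs_eq_iff_quotient[of _ _ u] bs_eq_iff_quotient[of _ _ "subst x y u"]
  using assms[of "winv u @ v"] by (simp add: subst_append subst_winv)

definition bs_class :: "int \<Rightarrow> int \<Rightarrow> bs_gen word \<Rightarrow> bs_gen word set" where
  "bs_class m n w = word_rel (bs_rel m n) `` {w}"

lemma bs_class_eq_iff: "bs_class m n u = bs_class m n v \<longleftrightarrow> bs_eq m n u v"
  unfolding bs_class_def bs_eq_iff_class ..

lemma carrier_BS: "carrier (BS m n) = range (bs_class m n)"
  unfolding BS_def carrier_presented_group bs_class_def ..

lemma mult_BS: "bs_class m n u \<otimes>\<^bsub>BS m n\<^esub> bs_class m n v = bs_class m n (u @ v)"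
  unfolding BS_def bs_class_def by (rule mult_presented_group)

lemma one_BS: "\<one>\<^bsub>BS m n\<^esub> = bs_class m n []"
  unfolding BS_def bs_class_def by (rule one_presented_group)

lemma inv_BS: "inv\<^bsub>BS m n\<^esub> (bs_class m n w) = bs_class m n (winv w)"
  using bs_eq_winv_left
  by (intro group.inv_equality[OF group_BS]) (auto simp: mult_BS one_BS bs_class_eq_iff carrier_BS)

text \<open>
  A homomorphism is determined by the images of the two generators.
\<close>

lemma hom_subst:
  assumes h: "h \<in> hom (BS r s) (BS m n)"
    and x: "h (bs_class r s [(bs_gen.a, True)]) = bs_class m n x"
    and y: "h (bs_class r s [(bs_gen.t, True)]) = bs_class m n y"
  shows "h (bs_class r s w) = bs_class m n (subst x y w)"
proof (induction w)
  interpret group_hom "BS r s" "BS m n" h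
    using h by (simp add: group_hom_def group_hom_axioms_def group_BS)
  case Nil
  show ?case using hom_one by (simp add: one_BS)
  case (Cons c w)
  have gen: "h (bs_class r s [(z, True)]) = bs_class m n (subst x y [(z, True)])" for z
    using x y by (cases z) simp_all
  have "h (bs_class r s (winv [(z, True)])) = bs_class m n (winv (subst x y [(z, True)]))" for z
    using hom_inv[of "bs_class r s [(z, True)]"] by (simp only: inv_BS gen) (auto simp: carrier_BS)
  then have inv_gen: "h (bs_class r s [(z, False)]) = bs_class m n (subst x y [(z, False)])" for z
    using subst_winv[of x y "[(z, True)]"] by (simp add: winv_def)
  have "h (bs_class r s [c]) = bs_class m n (subst x y [c])"
    using gen inv_gen by (cases c; cases "snd c") simp_all
  then have "h (bs_class r s ([c] @ w)) = bs_class m n (subst x y [c] @ subst x y w)"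
    unfolding mult_BS[symmetric] using Cons hom_mult[of "bs_class r s [c]" "bs_class r s w"]
    by (simp add: carrier_BS)
  then show ?case by simp
qed

theorem embeds_iff_subst:
  "embeds_in (BS r s) (BS m n) \<longleftrightarrow> (\<exists>x y. \<forall>w. bs_eq r s w [] \<longleftrightarrow> bs_eq m n (subst x y w) [])"
proof
  assume "embeds_in (BS r s) (BS m n)"
  then obtain H h where H: "subgroup H (BS m n)" and h: "h \<in> iso (BS r s) (BS m n\<lparr>carrier := H\<rparr>)"
    unfolding embeds_in_def is_iso_def by blast
  have "H \<subseteq> carrier (BS m n)" using H by (rule subgroup.subset)
  then have hom: "h \<in> hom (BS r s) (BS m n)" and inj: "inj_on h (carrier (BS r s))"
    using h by (auto simp: iso_def hom_def bij_betw_def)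
  have "h (bs_class r s w) \<in> range (bs_class m n)" for w
    using hom_in_carrier[OF hom, of "bs_class r s w"] by (simp add: carrier_BS)
  then obtain x y where "h (bs_class r s [(bs_gen.a, True)]) = bs_class m n x"
    "h (bs_class r s [(bs_gen.t, True)]) = bs_class m n y"
    by (meson rangeE)
  note subst = hom_subst[OF hom this]
  have "bs_eq r s w [] \<longleftrightarrow> bs_eq m n (subst x y w) []" for w
    using inj_on_eq_iff[OF inj, of "bs_class r s w" "bs_class r s []"] subst[of w] subst[of "[]"]
    by (auto simp: carrier_BS bs_class_eq_iff)
  then show "\<exists>x y. \<forall>w. bs_eq r s w [] \<longleftrightarrow> bs_eq m n (subst x y w) []" by blast
next
  assume "\<exists>x y. \<forall>w. bs_eq r s w [] \<longleftrightarrow> bs_eq m n (subst x y w) []"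
  then obtain x y where xy: "\<And>w. bs_eq r s w [] \<longleftrightarrow> bs_eq m n (subst x y w) []" by blast
  note eq = subst_bs_eq_iff[OF xy]
  define h where "h C = bs_class m n (subst x y (SOME w. C = bs_class r s w))" for C
  have h: "h (bs_class r s w) = bs_class m n (subst x y w)" for w
  proof -
    have "bs_class r s w = bs_class r s (SOME w'. bs_class r s w = bs_class r s w')"
      by (rule someI_ex) blast
    then show ?thesis unfolding h_def bs_class_eq_iff eq[symmetric] using bs_class_eq_iff bs_eq_sym by blast
  qed
  have hom: "h \<in> hom (BS r s) (BS m n)"
    by (rule homI) (auto simp: carrier_BS mult_BS h subst_append)
  interpret group_hom "BS r s" "BS m n" h
    using hom by (simp add: group_hom_def group_hom_axioms_def group_BS)
  have inj: "inj_on h (carrier (BS r s))"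
    unfolding carrier_BS by (rule inj_onI) (elim rangeE, simp only: h bs_class_eq_iff eq)
  have "h \<in> iso (BS r s) (BS m n\<lparr>carrier := h ` carrier (BS r s)\<rparr>)"
    using hom inj by (auto simp: iso_def hom_def bij_betw_def)
  then show "embeds_in (BS r s) (BS m n)"
    unfolding embeds_in_def is_iso_def using img_is_subgroup by blast
qed

section \<open>Construction of embeddings\<close>

context pingpong
begin

text \<open>
  If \<open>a\<^sup>i\<close> and \<open>y\<close> play ping-pong with the exponents \<open>r, s\<close>, then the action of \<open>BS(r,s)\<close> through them is
  faithful, so the substitution is injective.
\<close>

lemma embeds_if_pingpong:
  assumes "pingpong (\<lambda>k. A (i * k)) (act y) r s Xp Xm B'"
  shows "embeds_in (BS r s) (BS m n)"
proof -
  interpret H: pingpong "\<lambda>k. A (i * k)" "act y" r s Xp Xm B' by (rule assms)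
  have "bs_eq r s w [] \<longleftrightarrow> bs_eq m n (subst (apow i) y w) []" for w
    using H.act_eq_iff_bs_eq[of w "[]"] act_eq_iff_bs_eq[of "subst (apow i) y w" "[]"]
      word_act_subst[of "apow i" y w] by (simp add: act_wpow_apow)
  then show ?thesis unfolding embeds_iff_subst by blast
qed

lemma T_pow_in_Yp: "w \<notin> Ym \<Longrightarrow> (T ^^ Suc j) w \<in> Yp"
  by (induction j) (use T_in_Yp_iff Yp_Ym[of _ 0] in auto)

text \<open>
  A power \<open>a\<^sup>c\<close> that carries one point beyond the path \<open>t\<^sup>j\<close> to another such point fixes all edges of that path. Each
  edge forces divisibility by \<open>n\<close>, and the coprimality of \<open>m'\<close> and \<open>n'\<close> turns the sequence of these conditions into
  \<open>g n'\<^sup>j dvd c\<close>.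
\<close>

lemma descend:
  assumes mn: "m = g * m'" "n = g * n'" "coprime m' n'" "m \<noteq> 0" "n \<noteq> 0"
    and z: "z1 \<notin> Ym" "z2 \<notin> Ym"
    and eq: "A c ((T ^^ Suc j) z1) = (T ^^ Suc j) z2"
  shows "\<exists>c1. c = g * n' ^ Suc j * c1 \<and> A (g * m' ^ Suc j * c1) z1 = z2"
  using eq
proof (induction j arbitrary: c)
  case (0 c)
  have "n dvd c" using Yp_free[of "T z1" c] 0 T_in_Yp_iff z by auto
  then obtain d where d: "c = n * d" by (auto simp: dvd_def)
  have "T (A (m * d) z1) = T z2" using 0 T_A_mult d by simp
  then have "A (m * d) z1 = z2" using bij_T by (metis T_inv_T(2))
  then show ?case using d mn by auto
next
  case (Suc j c)
  let ?w1 = "(T ^^ Suc j) z1" and ?w2 = "(T ^^ Suc j) z2"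
  have eq: "A c (T ?w1) = T ?w2" using Suc.prems by simp
  have "T ?w1 \<in> Yp" "T ?w2 \<in> Yp" using T_pow_in_Yp[of _ "Suc j"] z by auto
  then have "n dvd c" using Yp_free[of "T ?w1" c] eq by auto
  then obtain d where d: "c = n * d" by (auto simp: dvd_def)
  have "T (A (m * d) ?w1) = T ?w2" using eq T_A_mult d by simp
  then have "A (m * d) ?w1 = ?w2" by (metis T_inv_T(2))
  then obtain e where e: "m * d = g * n' ^ Suc j * e" "A (g * m' ^ Suc j * e) z1 = z2"
    using Suc.IH by blast
  have eq': "m' * d = n' ^ Suc j * e" using e(1) mn by (simp add: mult.assoc)
  have "coprime (n' ^ Suc j) m'" using mn(3) by (simp add: coprime_commute)
  moreover have "n' ^ Suc j dvd m' * d" using eq' by simp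
  ultimately have "n' ^ Suc j dvd d" by (simp add: coprime_dvd_mult_right_iff)
  then obtain f where f: "d = n' ^ Suc j * f" by (auto simp: dvd_def)
  have "n' \<noteq> 0" using mn by auto
  then have "e = m' * f" using eq' f by auto
  then show ?case using d e(2) f mn by (auto intro!: exI[of _ f] simp: mult_ac)
qed

text \<open>
  The path \<open>t\<^sup>M a t\<^bsup>-N\<^esup>\<close> is fixed by \<open>a\<^sup>c\<close> iff \<open>g n'\<^sup>M m'\<^sup>L dvd c\<close>, since after the first piece \<open>c\<close> has become
  \<open>c m'\<^sup>M / n'\<^sup>M\<close>, and \<open>N - M = L\<close> further factors \<open>m'\<close> are needed. Read from the other end, \<open>t\<^bsup>-M\<^esup> a t\<^sup>N\<close> is fixed iff
  \<open>g m'\<^sup>M n'\<^sup>L dvd c\<close>, and the next piece \<open>t\<^bsup>-N\<^esup>\<close> then costs nothing more. The value of \<open>i\<close> makes these bounds equal to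
  \<open>i s\<close> and \<open>i r\<close>. The letters \<open>a\<^bsup>\<plusminus>1\<^esup>\<close> between the pieces prevent backtracking, which is where \<open>|m|, |n| \<ge> 2\<close>
  enters.
\<close>

lemma zigzag_pingpong:
  assumes mn: "m = g * m'" "n = g * n'" "coprime m' n'" "m \<noteq> 0" "n \<noteq> 0"
    and big: "\<not> m dvd 1" "\<not> n dvd 1"
    and L: "L \<ge> 1" and q: "q \<noteq> 0" and i: "i * q = g * (m' * n') ^ L"
    and rs: "r = q * m' ^ k" "s = q * n' ^ k"
  shows "\<exists>y Xp Xm. pingpong (\<lambda>j. A (i * j)) (act y) r s Xp Xm B"
proof -
  interpret D: pingpong A "finv T" n m Ym Yp B by (rule dual)
  define M where "M = L + k"
  define N where "N = M + L"
  obtain M' N' where MN: "M = Suc M'" "N = Suc N'" using L by (auto simp: M_def N_def Suc_le_eq gr0_conv_Suc)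
  define U where "U = finv T"
  have gmn: "g \<noteq> 0" "m' \<noteq> 0" "n' \<noteq> 0" using mn by auto
  have i0: "i \<noteq> 0" using i gmn by auto
  have i_r: "i * r = g * m' ^ M * n' ^ L" and i_s: "i * s = g * m' ^ L * n' ^ M"
    using i by (simp_all add: rs M_def power_add power_mult_distrib mult.assoc[symmetric])
  have TU [simp]: "(T ^^ j) ((U ^^ j) w) = w" "(U ^^ j) ((T ^^ j) w) = w" for j w
    by (simp_all add: U_def T_pow_inv_T_pow)
  define y where "y = replicate M (bs_gen.t, True) @ apow 1 @ replicate N (bs_gen.t, False) @ apow 1
    @ replicate N (bs_gen.t, True) @ apow (-1) @ replicate N (bs_gen.t, False) @ apow (-1) @ replicate M (bs_gen.t, True)"
  have y: "act y w = (T ^^ M) (A 1 ((U ^^ N) (A 1 ((T ^^ N) (A (-1) ((U ^^ N) (A (-1) ((T ^^ M) w))))))))" for w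
    by (simp add: y_def word_act_append act_t_powers U_def)
  \<comment> \<open>\<open>Xp\<close> is the half-tree beyond the last edge of \<open>t\<^sup>M a t\<^bsup>-N\<^esup>\<close>, and \<open>Xm\<close> is the preimage of its complement
    under \<open>y\<close>.\<close>
  define z1 where "z1 v = A 1 ((U ^^ N) v)" for v
  define z2 where "z2 v = A 1 ((U ^^ N) (A (- 1) v))" for v
  define Xp where "Xp = {(T ^^ M) (z1 v) | v. v \<notin> Yp}"
  define Xm where "Xm = {(U ^^ M) (A 1 ((T ^^ N) (z2 v))) | v. v \<in> Yp}"
  have Tp: "(T ^^ M) w \<in> Yp" "(T ^^ N) w \<in> Yp" if "w \<notin> Ym" for w
    using T_pow_in_Yp that MN by auto
  have Up: "(U ^^ M) w \<in> Ym" "(U ^^ N) w \<in> Ym" if "w \<notin> Yp" for w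
    using D.T_pow_in_Yp that MN by (auto simp: U_def)
  have A1: "A 1 w \<notin> Ym" "A 1 w \<notin> Yp" if "w \<in> Ym" for w
    using Ym_free[of w 1] big D.Yp_Ym that by auto
  have A1': "A 1 w \<notin> Yp" "A (- 1) w \<notin> Yp" if "w \<in> Yp" for w
    using Yp_free[of w 1] Yp_free[of w "- 1"] big that by auto
  have z1: "z1 v \<notin> Ym" if "v \<notin> Yp" for v using A1(1) Up(2) that by (simp add: z1_def)
  have z2: "z2 v \<notin> Ym" if "v \<in> Yp" for v using A1(1) Up(2) A1' that by (simp add: z2_def)
  have Xp: "Xp \<subseteq> Yp" using Tp z1 by (auto simp: Xp_def)
  have Xm: "Xm \<subseteq> Ym" using Tp Up z2 A1' by (auto simp: Xm_def)
  have "pingpong (\<lambda>j. A (i * j)) (act y) r s Xp Xm B"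
  proof unfold_locales
    show "A (i * (j + k)) w = A (i * j) (A (i * k) w)" for j k w by (simp add: distrib_left A_add)
    show "bij (act y)" by (rule bij_act)
    show "act y (A (i * r) w) = A (i * s) (act y w)" for w
    proof -
      note up = T_pow_A[OF mn(1,2)] and down = D.T_pow_A[OF mn(2,1), folded U_def]
      have "(T ^^ M) (A (i * r) v) = A (g * n' ^ N * 1) ((T ^^ M) v)" for v
        using up[of M "n' ^ L" v] by (simp add: i_r N_def power_add mult_ac)
      moreover have "(T ^^ M) (A (g * m' ^ N * 1) v) = A (i * s) ((T ^^ M) v)" for v
        using up[of M "m' ^ L" v] by (simp add: i_s N_def power_add mult_ac)
      ultimately show ?thesis
        unfolding y by (simp only: up down A_comm[of "- 1" "g * n' ^ N * 1"] A_comm[of "- 1" "g * m' ^ N * 1"]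
            A_comm[of 1 "g * n' ^ N * 1"] A_comm[of 1 "g * m' ^ N * 1"])
    qed
    show "act y w \<in> Xp \<longleftrightarrow> w \<notin> Xm" for w
    proof -
      define v where "v = A 1 ((T ^^ N) (A (-1) ((U ^^ N) (A (-1) ((T ^^ M) w)))))"
      have yw: "act y w = (T ^^ M) (z1 v)" by (simp add: y v_def z1_def)
      have w: "w = (U ^^ M) (A 1 ((T ^^ N) (z2 v)))"
        using A_neg_A(2)[of 1] A_neg_A(1)[of 1] by (simp add: v_def z2_def)
      have "(T ^^ M) (z1 v) = (T ^^ M) (z1 v') \<Longrightarrow> v = v'" for v'
        unfolding z1_def by (metis TU A_neg_A(1))
      then have "act y w \<in> Xp \<longleftrightarrow> v \<notin> Yp" unfolding yw Xp_def by auto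
      moreover have "(U ^^ M) (A 1 ((T ^^ N) (z2 v))) = (U ^^ M) (A 1 ((T ^^ N) (z2 v'))) \<Longrightarrow> v = v'" for v'
        unfolding z2_def by (metis TU A_neg_A)
      then have "w \<in> Xm \<longleftrightarrow> v \<in> Yp" unfolding Xm_def by (subst w) auto
      ultimately show ?thesis by blast
    qed
    show "A (i * k) w \<notin> Xm" if "w \<in> Xp" for w k using Yp_Ym[of w "i * k"] that Xp Xm by auto
    show "s dvd j" if w: "w \<in> Xp" and Aw: "A (i * j) w \<in> Xp" for w j
    proof -
      obtain v where v: "w = (T ^^ M) (z1 v)" "v \<notin> Yp" using w by (auto simp: Xp_def)
      obtain v' where v': "A (i * j) w = (T ^^ M) (z1 v')" "v' \<notin> Yp" using Aw by (auto simp: Xp_def)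
      obtain c1 where c1: "i * j = g * n' ^ M * c1" "A (g * m' ^ M * c1) (z1 v) = z1 v'"
        using descend[OF mn z1[OF v(2)] z1[OF v'(2)], of "i * j" M'] v v' MN by auto
      have "A 1 (A (g * m' ^ M * c1) ((U ^^ N) v)) = A 1 ((U ^^ N) v')"
        using c1(2) A_comm[of 1] by (simp add: z1_def)
      then have "A (g * m' ^ M * c1) ((U ^^ N) v) = (U ^^ N) v'" by (metis A_neg_A(1))
      then obtain c2 where "g * m' ^ M * c1 = g * m' ^ N * c2"
        using D.descend[OF mn(2,1) _ mn(5,4) v(2) v'(2), of "g * m' ^ M * c1" N'] mn(3) MN
        by (auto simp: U_def coprime_commute)
      then have "c1 = m' ^ L * c2" using gmn by (simp add: N_def power_add mult.assoc)
      then have "i * j = i * (s * c2)" using c1(1) i_s by (simp add: mult_ac)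
      then show ?thesis using i0 by simp
    qed
    show "r dvd j" if w: "w \<in> Xm" and Aw: "A (i * j) w \<in> Xm" for w j
    proof -
      let ?z = "\<lambda>v. A 1 ((T ^^ N) (z2 v))"
      have z: "?z v \<notin> Yp" if "v \<in> Yp" for v using A1' Tp z2 that by auto
      obtain v where v: "w = (U ^^ M) (?z v)" "v \<in> Yp" using w by (auto simp: Xm_def)
      obtain v' where v': "A (i * j) w = (U ^^ M) (?z v')" "v' \<in> Yp" using Aw by (auto simp: Xm_def)
      obtain c1 where c1: "i * j = g * m' ^ M * c1" "A (g * n' ^ M * c1) (?z v) = ?z v'"
        using D.descend[OF mn(2,1) _ mn(5,4) z[OF v(2)] z[OF v'(2)], of "i * j" M'] mn(3) v v' MN
        by (auto simp: U_def coprime_commute)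
      have "A 1 (A (g * n' ^ M * c1) ((T ^^ N) (z2 v))) = A 1 ((T ^^ N) (z2 v'))"
        using c1(2) A_comm[of 1] by simp
      then have "A (g * n' ^ M * c1) ((T ^^ N) (z2 v)) = (T ^^ N) (z2 v')" by (metis A_neg_A(1))
      then obtain c2 where "g * n' ^ M * c1 = g * n' ^ N * c2"
        using descend[OF mn z2[OF v(2)] z2[OF v'(2)], of "g * n' ^ M * c1" N'] MN by auto
      then have "c1 = n' ^ L * c2" using gmn by (simp add: N_def power_add mult.assoc)
      then have "i * j = i * (r * c2)" using c1(1) i_r by (simp add: mult_ac)
      then show ?thesis using i0 by simp
    qed
    show "w \<notin> Xp \<and> w \<notin> Xm" if "w \<in> B" for w using B_Y that Xp Xm by auto
    show "j = 0" if "A (i * j) w = w" for j w using A_free[OF that] i0 by simp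
  qed (use B_A B_ne in auto)
  then show ?thesis by blast
qed

text \<open>
  In the solvable case \<open>t\<^sup>k\<close> conjugates \<open>a\<^bsup>m^k\<^esup>\<close> to \<open>a\<^bsup>n^k\<^esup>\<close>, and \<open>m^k\<close> and \<open>r\<close> are units. As \<open>r\<close> is a unit, the half
  \<open>Ym\<close> can be kept, while \<open>Yp\<close> shrinks to the half-tree beyond the path \<open>t\<^sup>k\<close>. The factor 1 is the exponent of \<open>x = a\<^sup>1\<close>.
\<close>

lemma power_pingpong:
  assumes m: "\<bar>m\<bar> = 1" and n: "n \<noteq> 0" and r: "\<bar>r\<bar> = 1" and k: "k \<ge> 1" and eq: "s * m ^ k = r * n ^ k"
  shows "\<exists>y Xp Xm. pingpong (\<lambda>j. A (1 * j)) (act y) r s Xp Xm B"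
proof -
  obtain k' where k': "k = Suc k'" using k by (auto simp: Suc_le_eq gr0_conv_Suc)
  have mm: "m ^ k * m ^ k = 1" using m by (metis abs_mult_self_eq power_one power_mult_distrib mult_1)
  have mn: "m = 1 * m" "n = 1 * n" "coprime m n" "m \<noteq> 0" "n \<noteq> 0"
    using m n by (auto simp: abs_if split: if_splits)
  have s: "s = n ^ k * (r * m ^ k)" using eq mm by (metis mult.assoc mult.commute mult.right_neutral)
  define Xp where "Xp = {(T ^^ k) z | z. z \<notin> Ym}"
  have Xp: "Xp \<subseteq> Yp" using T_pow_in_Yp by (auto simp: Xp_def k')
  have y: "act (replicate k (bs_gen.t, True)) = T ^^ k" by (rule act_t_powers)
  have inj: "(T ^^ k) w = (T ^^ k) w' \<longleftrightarrow> w = w'" for w w'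
    using act_eq_iff[of "replicate k (bs_gen.t, True)"] unfolding y .
  have "pingpong (\<lambda>j. A (1 * j)) (act (replicate k (bs_gen.t, True))) r s Xp Ym B"
  proof unfold_locales
    show "bij (act (replicate k (bs_gen.t, True)))" by (rule bij_act)
    show "act (replicate k (bs_gen.t, True)) (A (1 * r) w) = A (1 * s) (act (replicate k (bs_gen.t, True)) w)" for w
    proof -
      have mr: "m ^ k * (r * m ^ k) = r" using mm by (metis mult.assoc mult.commute mult.right_neutral)
      show ?thesis using T_pow_A[OF mn(1,2), of k "r * m ^ k" w] by (simp only: y s mult_1 mr)
    qed
    show "act (replicate k (bs_gen.t, True)) w \<in> Xp \<longleftrightarrow> w \<notin> Ym" for w
      unfolding y Xp_def by (auto simp: inj)
    show "s dvd j" if w: "w \<in> Xp" "A (1 * j) w \<in> Xp" for w j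
    proof -
      obtain z z' where z: "z \<notin> Ym" "z' \<notin> Ym" "w = (T ^^ k) z" "A j w = (T ^^ k) z'"
        using w by (auto simp: Xp_def)
      obtain c where c: "j = n ^ k * c" using descend[OF mn z(1,2), of j k'] z k' by auto
      have "is_unit (r * m ^ k)" using r m by (simp add: zdvd1_eq abs_mult power_abs)
      then have "r * m ^ k dvd c" by (rule unit_imp_dvd)
      then show ?thesis unfolding s c by (rule mult_dvd_mono[OF dvd_refl])
    qed
    show "r dvd j" for j using r by (simp add: unit_imp_dvd zdvd1_eq)
    show "A (1 * j) w \<notin> Ym" if "w \<in> Xp" for w j using Xp Yp_Ym that by auto
    show "w \<notin> Xp \<and> w \<notin> Ym" if "w \<in> B" for w using B_Y that Xp by auto
  qed (use A_add B_A B_ne A_free in auto)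
  then show ?thesis by blast
qed

end

abbreviation (input) same_part_condition :: "int \<Rightarrow> int \<Rightarrow> int \<Rightarrow> int \<Rightarrow> bool" where
  "same_part_condition m n r s \<equiv> \<forall>(p::int) (\<alpha>::nat). Factorial_Ring.prime p \<longrightarrow>
        p ^ \<alpha> dvd m \<and> p ^ \<alpha> dvd n \<and> \<not> p ^ (\<alpha> + 1) dvd m \<and> \<not> p ^ (\<alpha> + 1) dvd n \<longrightarrow>
        \<not> p ^ (\<alpha> + 1) dvd r \<and> \<not> p ^ (\<alpha> + 1) dvd s"

lemma multiplicity_le_abs:
  fixes p q :: int
  assumes "Factorial_Ring.prime p" "q \<noteq> 0"
  shows "multiplicity p q \<le> nat \<bar>q\<bar>"
proof -
  let ?e = "multiplicity p q"
  have "int ?e \<le> 2 ^ ?e" using of_nat_less_two_power[of ?e] by (simp add: less_imp_le)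
  also have "\<dots> \<le> p ^ ?e" using prime_ge_2_int[OF assms(1)] by (intro power_mono) auto
  also have "\<dots> \<le> \<bar>q\<bar>" using assms(2) multiplicity_dvd[of p q] by (intro zdvd_imp_le) auto
  finally show ?thesis by simp
qed

text \<open>
  Cancelling \<open>g\<^sup>k\<close> and using the coprimality of \<open>m'\<close> and \<open>n'\<close> gives \<open>q\<close>. The divisibility is checked prime by
  prime. A prime dividing \<open>m' n'\<close> is taken care of by a large \<open>L\<close>. Any other prime has the same multiplicity \<open>\<alpha>\<close> in
  \<open>m\<close>, \<open>n\<close> and \<open>g\<close>, and the hypothesis bounds its multiplicity in \<open>r\<close>, and so in \<open>q\<close>, by \<open>\<alpha>\<close>.
\<close>

lemma common_part_decomposition:
  fixes m n r s :: int
  assumes nz: "m \<noteq> 0" "n \<noteq> 0" "r \<noteq> 0" "s \<noteq> 0"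
    and eq: "r * n ^ k = s * m ^ k" and cond: "same_part_condition m n r s"
  obtains g m' n' q i and L :: nat where "m = g * m'" "n = g * n'" "coprime m' n'" "r = q * m' ^ k" "s = q * n' ^ k"
    "q \<noteq> 0" "L \<ge> 1" "i * q = g * (m' * n') ^ L"
proof -
  define g where "g = gcd m n"
  have g: "g \<noteq> 0" using nz by (simp add: g_def)
  obtain m' n' where "m = m' * g" "n = n' * g" and cop: "coprime m' n'"
    using gcd_coprime_exists[of m n] g unfolding g_def by blast
  then have mn: "m = g * m'" "n = g * n'" "coprime m' n'" by (simp_all only: mult.commute)
  have mn0: "m' \<noteq> 0" "n' \<noteq> 0" using mn nz by auto
  have eq': "r * n' ^ k = s * m' ^ k"
    using eq g by (simp add: mn power_mult_distrib mult.left_commute[of _ "g ^ k"])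
  have "m' ^ k dvd r * n' ^ k" using eq' by simp
  moreover have "coprime (m' ^ k) (n' ^ k)" using mn(3) by simp
  ultimately have "m' ^ k dvd r" by (simp add: coprime_dvd_mult_left_iff)
  then obtain q where r: "r = q * m' ^ k" by (auto simp: dvd_def mult.commute)
  have s: "s = q * n' ^ k" using eq' r mn0 by (simp add: mult_ac)
  have q: "q \<noteq> 0" using r nz by auto
  define L where "L = Suc (nat \<bar>q\<bar>)"
  have "q dvd g * (m' * n') ^ L"
  proof (rule multiplicity_le_imp_dvd)
    fix p :: int
    assume p: "Factorial_Ring.prime p"
    show "multiplicity p q \<le> multiplicity p (g * (m' * n') ^ L)"
    proof (cases "p dvd m' * n'")
      case True
      then have "p ^ L dvd g * (m' * n') ^ L" by (simp add: dvd_mult dvd_power_same)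
      then have "L \<le> multiplicity p (g * (m' * n') ^ L)"
        using g mn0 p by (intro multiplicity_geI) (auto simp: not_prime_unit)
      then show ?thesis using multiplicity_le_abs[OF p q] by (simp add: L_def)
    next
      case False
      let ?\<alpha> = "multiplicity p g"
      have "coprime (p ^ (?\<alpha> + 1)) m'" "coprime (p ^ (?\<alpha> + 1)) n'"
        using False p by (auto intro!: prime_imp_coprime simp del: power_Suc)
      moreover have "\<not> p ^ (?\<alpha> + 1) dvd g"
        using p g power_dvd_iff_le_multiplicity[of g p "?\<alpha> + 1"] by (auto simp: not_prime_unit)
      ultimately have "\<not> p ^ (?\<alpha> + 1) dvd m" "\<not> p ^ (?\<alpha> + 1) dvd n"
        unfolding mn(1,2) by (simp_all add: coprime_dvd_mult_left_iff del: power_Suc)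
      moreover have "p ^ ?\<alpha> dvd m" "p ^ ?\<alpha> dvd n" by (simp_all add: mn multiplicity_dvd)
      ultimately have "\<not> p ^ (?\<alpha> + 1) dvd r" using cond p by blast
      then have "\<not> p ^ (?\<alpha> + 1) dvd q" unfolding r by (meson dvd_mult2)
      then have "multiplicity p q \<le> ?\<alpha>"
        using p q power_dvd_iff_le_multiplicity[of q p "?\<alpha> + 1"] by (auto simp: not_prime_unit)
      also have "\<dots> \<le> multiplicity p (g * (m' * n') ^ L)"
        using g mn0 by (intro dvd_imp_multiplicity_le) auto
      finally show ?thesis .
    qed
  qed (use q in auto)
  then obtain i where "i * q = g * (m' * n') ^ L" by (metis dvdE mult.commute)
  then show ?thesis by (rule that[OF mn r s q, rotated]) (simp add: L_def)
qed

lemma (in pingpong) embedding_pingpong_nonneg: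
  assumes nz: "m \<noteq> 0" "n \<noteq> 0" "r \<noteq> 0" "s \<noteq> 0" and rs: "\<not> (\<bar>r\<bar> = 1 \<and> \<bar>s\<bar> = 1)"
    and eq: "r * n ^ k = s * m ^ k" and cond: "same_part_condition m n r s"
    and unit: "\<bar>m\<bar> = 1 \<or> \<bar>n\<bar> = 1 \<Longrightarrow> \<bar>r\<bar> = 1 \<or> \<bar>s\<bar> = 1"
  shows "\<exists>i y Xp Xm. pingpong (\<lambda>j. A (i * j)) (act y) r s Xp Xm B"
proof -
  have abs_eq: "\<bar>r\<bar> * \<bar>n\<bar> ^ k = \<bar>s\<bar> * \<bar>m\<bar> ^ k" using eq by (metis abs_mult power_abs)
  consider "\<bar>m\<bar> = 1" | "\<bar>n\<bar> = 1" | "\<bar>m\<bar> \<noteq> 1" "\<bar>n\<bar> \<noteq> 1" by blast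
  then show ?thesis
  proof cases
    case 1
    then have "\<bar>s\<bar> = \<bar>r\<bar> * \<bar>n\<bar> ^ k" using abs_eq by simp
    then have "\<bar>r\<bar> = 1" if "\<bar>s\<bar> = 1"
      using that abs_zmult_eq_1[of r "n ^ k"] by (simp add: abs_mult power_abs)
    then have r: "\<bar>r\<bar> = 1" using unit 1 by blast
    have "k \<ge> 1" using \<open>\<bar>s\<bar> = \<bar>r\<bar> * \<bar>n\<bar> ^ k\<close> r rs by (cases k) auto
    then show ?thesis using power_pingpong[OF 1 nz(2) r _ eq[symmetric]] by blast
  next
    case 2
    interpret D: pingpong A "finv T" n m Ym Yp B by (rule dual)
    have "\<bar>r\<bar> = \<bar>s\<bar> * \<bar>m\<bar> ^ k" using 2 abs_eq by simp
    then have "\<bar>s\<bar> = 1" if "\<bar>r\<bar> = 1"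
      using that abs_zmult_eq_1[of s "m ^ k"] by (simp add: abs_mult power_abs)
    then have s: "\<bar>s\<bar> = 1" using unit 2 by blast
    have "k \<ge> 1" using \<open>\<bar>r\<bar> = \<bar>s\<bar> * \<bar>m\<bar> ^ k\<close> s rs by (cases k) auto
    then obtain y Xp Xm where "pingpong (\<lambda>j. A (1 * j)) (word_act A (finv T) y) s r Xp Xm B"
      using D.power_pingpong[OF 2 nz(1) s _ eq] by blast
    then interpret E: pingpong "\<lambda>j. A (1 * j)" "word_act A (finv T) y" s r Xp Xm B .
    have "finv (word_act A (finv T) y) = act (winv (flip_t y))" by (simp only: act_flip_t finv_act)
    then show ?thesis using E.dual by metis
  next
    case 3
    have "\<not> m dvd 1" "\<not> n dvd 1" using 3 by (simp_all add: zdvd1_eq)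
    then show ?thesis
      using common_part_decomposition[OF nz eq cond] zigzag_pingpong nz by metis
  qed
qed

text \<open>
  A negative exponent is made positive by replacing \<open>t\<close> by \<open>t\<^sup>-\<^sup>1\<close>.
\<close>

lemma (in pingpong) embeds_if_conditions:
  assumes nz: "m \<noteq> 0" "n \<noteq> 0" "r \<noteq> 0" "s \<noteq> 0" and rs: "\<not> (\<bar>r\<bar> = 1 \<and> \<bar>s\<bar> = 1)"
    and power: "(of_int r / of_int s :: rat) = (of_int m / of_int n) powi k"
    and cond: "same_part_condition m n r s"
    and unit: "\<bar>m\<bar> = 1 \<or> \<bar>n\<bar> = 1 \<Longrightarrow> \<bar>r\<bar> = 1 \<or> \<bar>s\<bar> = 1"
  shows "embeds_in (BS r s) (BS m n)"
proof (cases "0 \<le> k")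
  case True
  have "(of_int r / of_int s :: rat) = of_int m ^ nat k / of_int n ^ nat k"
    using power True by (simp add: power_int_def power_divide)
  then have "(of_int (r * n ^ nat k) :: rat) = of_int (s * m ^ nat k)"
    using nz by (simp add: frac_eq_eq mult.commute)
  then have "r * n ^ nat k = s * m ^ nat k" by (simp only: of_int_eq_iff)
  from embedding_pingpong_nonneg[OF nz rs this cond unit] show ?thesis
    using embeds_if_pingpong by blast
next
  case False
  interpret D: pingpong A "finv T" n m Ym Yp B by (rule dual)
  have "(of_int r / of_int s :: rat) = of_int n ^ nat (- k) / of_int m ^ nat (- k)"
    using power False by (simp add: power_int_def power_divide)
  then have "(of_int (r * m ^ nat (- k)) :: rat) = of_int (s * n ^ nat (- k))"
    using nz by (simp add: frac_eq_eq mult.commute)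
  then have "r * m ^ nat (- k) = s * n ^ nat (- k)" by (simp only: of_int_eq_iff)
  then have "\<exists>i y Xp Xm. pingpong (\<lambda>j. A (i * j)) (word_act A (finv T) y) r s Xp Xm B"
    using D.embedding_pingpong_nonneg[OF nz(2,1,3,4) rs _ _ unit] cond by blast
  then show ?thesis unfolding act_flip_t using embeds_if_pingpong by blast
qed

section \<open>Necessary conditions\<close>

context pingpong
begin

text \<open>
  \<open>t\<langle>a\<rangle>t\<^sup>-\<^sup>1 \<inter> \<langle>a\<rangle> = \<langle>a\<^sup>n\<rangle>\<close>, with the exponents on both sides.
\<close>

lemma edge_powers_if_commute:
  assumes nz: "m \<noteq> 0"
    and eq: "\<And>w. A i (T w) = T (A j w)"
  shows "n dvd i" "m dvd j"
proof -
  obtain b where b: "b \<in> B" using B_ne by blast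
  have "T b \<in> Yp" "T (A j b) \<in> Yp" using B_Y[OF b] B_Y[OF B_A[OF b, of j]] T_in_Yp_iff by auto
  then show n: "n dvd i" using Yp_free[of "T b" i] eq by simp
  then obtain c where c: "i = n * c" by (auto simp: dvd_def)
  then have "T (A (m * c) b) = T (A j b)" using T_A_mult eq by simp
  then have "A (m * c) b = A j b" by (metis T_inv_T(2))
  then have "A (m * c - j) b = b" using A_add[of "- j" "m * c" b] by simp
  then have "m * c - j = 0" by (rule A_free)
  then show "m dvd j" by (metis dvd_triv_left eq_iff_diff_eq_0)
qed

lemma conjugate_not_commute:
  assumes "\<not> m dvd 1" "\<not> n dvd 1"
  shows "\<exists>w. A 1 (T (A 1 (finv T w))) \<noteq> T (A 1 (finv T (A 1 w)))"
proof -
  obtain b where b: "b \<in> B" using B_ne by blast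
  have T_A_inv: "T (A 1 (finv T w)) \<in> Yp" if "w \<in> B" for w
    using B_Y[OF that] Ym_free[of "finv T w" 1] assms by (auto simp: T_in_Yp_iff finv_T_in_Ym_iff)
  have "A 1 (T (A 1 (finv T b))) \<notin> Yp" using Yp_free T_A_inv[OF b] assms by blast
  moreover have "T (A 1 (finv T (A 1 b))) \<in> Yp" using T_A_inv[OF B_A[OF b]] .
  ultimately show ?thesis by metis
qed

text \<open>
  After cancellation of \<open>a\<^sup>-\<^sup>1 t\<^sup>2\<close> on the left of the two products, the remaining words \<open>p\<close> and \<open>q\<close>
  put a base point into a translate of \<open>Ym\<close> and into \<open>Yp\<close> respectively.
\<close>

lemma conjugate_quotients_not_commute:
  fixes a t :: "bs_gen word"
  assumes "\<not> m dvd 1" "\<not> n dvd 1"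
  defines "a \<equiv> [(bs_gen.a, True)]" and "t \<equiv> [(bs_gen.t, True)]"
  defines "w2 \<equiv> winv a @ t @ t @ a @ winv t @ winv t"
    and "w4 \<equiv> winv a @ t @ t @ t @ t @ a @ winv t @ winv t @ winv t @ winv t"
  shows "act (w2 @ w4) \<noteq> act (w4 @ w2)"
proof
  assume eq: "act (w2 @ w4) = act (w4 @ w2)"
  obtain b where b: "b \<in> B" using B_ne by blast
  define U where "U = finv T"
  have acts: "act a = A 1" "act (winv a) = A (- 1)" "act t = T" "act (winv t) = U"
    by (auto simp: a_def t_def winv_def t_act_def U_def)
  define p where "p = A 1 (U (U (A (- 1) (T (T (T (T (A 1 (U (U (U (U b))))))))))))"
  define q where "q = T (T (A 1 (U (U (U (U (A (- 1) (T (T (A 1 (U (U b))))))))))))"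
  have "A (- 1) (T (T p)) = A (- 1) (T (T q))"
    using fun_cong[OF eq, of b] by (simp add: w2_def w4_def word_act_append acts p_def q_def U_def)
  then have pq: "p = q" by (metis A_neg_A(2) T_inv_T(2))
  have U: "U w \<in> Ym" if "w \<notin> Yp" for w using that by (simp add: U_def finv_T_in_Ym_iff)
  have T: "T w \<in> Yp" if "w \<notin> Ym" for w using that by (simp add: T_in_Yp_iff)
  have Am: "A 1 w \<notin> Ym" "A 1 w \<notin> Yp" "w \<notin> Yp" if "w \<in> Ym" for w
    using that Ym_free[of w 1] Ym_Yp[of w] Ym_Yp[of w 0] assms by auto
  have Ap: "A (- 1) w \<notin> Yp" "w \<notin> Ym" if "w \<in> Yp" for w
    using that Yp_free[of w "- 1"] Yp_Ym[of w 0] assms by auto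
  have U2: "U (U w) \<in> Ym" if "w \<notin> Yp" for w by (rule U[OF Am(3)[OF U[OF that]]])
  have U4: "U (U (U (U w))) \<in> Ym" if "w \<notin> Yp" for w by (rule U2[OF Am(3)[OF U2[OF that]]])
  have T2: "T (T w) \<in> Yp" if "w \<notin> Ym" for w by (rule T[OF Ap(2)[OF T[OF that]]])
  have T4: "T (T (T (T w))) \<in> Yp" if "w \<notin> Ym" for w by (rule T2[OF Ap(2)[OF T2[OF that]]])
  have b: "b \<notin> Yp" using B_Y b by blast
  have "p \<notin> Yp" "q \<in> Yp"
    unfolding p_def q_def
    by (rule Am(2)[OF U2[OF Ap(1)[OF T4[OF Am(1)[OF U4[OF b]]]]]],
        rule T2[OF Am(1)[OF U4[OF Ap(1)[OF T2[OF Am(1)[OF U2[OF b]]]]]]])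
  then show False using pq by simp
qed

end

context bs_action
begin

text \<open>
  Passing a letter \<open>t\<^bsup>\<plusminus>1\<^esup>\<close> exchanges a factor \<open>m = p\<^sup>\<alpha> m1\<close> for \<open>n = p\<^sup>\<alpha> n1\<close> or conversely, so the \<open>p\<close>-part
  of the exponent does not change, and once it is \<open>p\<^sup>\<alpha>\<close> it suffices for all later letters. The factor \<open>j\<close> keeps the
  statement stable under raising to powers.
\<close>

lemma prime_power_conj:
  assumes p: "Factorial_Ring.prime p" and mn: "m = p ^ \<alpha> * m1" "n = p ^ \<alpha> * n1" "\<not> p dvd m1" "\<not> p dvd n1"
  shows "\<exists>u v. \<not> p dvd u \<and> \<not> p dvd v \<and> (\<forall>j w. A (p ^ \<alpha> * u * j) (act h w) = act h (A (p ^ \<alpha> * v * j) w))"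
proof (induction h)
  case Nil
  have "\<not> p dvd 1" using p not_prime_unit by blast
  then show ?case by (intro exI[of _ 1]) simp
next
  case (Cons c h)
  obtain u v where uv: "\<not> p dvd u" "\<not> p dvd v"
    "\<And>j w. A (p ^ \<alpha> * u * j) (act h w) = act h (A (p ^ \<alpha> * v * j) w)" using Cons by blast
  obtain x e where c: "c = (x, e)" by fastforce
  show ?case
  proof (cases x)
    case a
    then have "A (p ^ \<alpha> * u * j) (act (c # h) w) = act (c # h) (A (p ^ \<alpha> * v * j) w)" for j w
      using uv(3) c A_comm[of "p ^ \<alpha> * u * j"] by simp
    then show ?thesis using uv by blast
  next
    case t
    define l where "l = edge_exp m1 n1 (\<not> e)"
    define l' where "l' = edge_exp m1 n1 e"
    have ll: "edge_exp m n (\<not> e) = p ^ \<alpha> * l" "edge_exp m n e = p ^ \<alpha> * l'" "\<not> p dvd l" "\<not> p dvd l'"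
      using mn by (auto simp: edge_exp_def l_def l'_def)
    have "A (p ^ \<alpha> * (l' * u) * j) (act (c # h) w) = act (c # h) (A (p ^ \<alpha> * (v * l) * j) w)" for j w
    proof -
      have "A (p ^ \<alpha> * (l' * u) * j) (act (c # h) w) = t_act e (A (edge_exp m n (\<not> e) * (u * j)) (act h w))"
        using t_act_A[of e "u * j" "act h w"] by (simp add: c t ll mult_ac)
      also have "edge_exp m n (\<not> e) * (u * j) = p ^ \<alpha> * u * (l * j)" by (simp add: ll mult_ac)
      finally show ?thesis unfolding uv(3) by (simp add: c t mult_ac)
    qed
    moreover have "\<not> p dvd l' * u" "\<not> p dvd v * l" using ll uv p by (simp_all add: prime_dvd_mult_iff)
    ultimately show ?thesis by blast
  qed
qed

text \<open>
  If \<open>n\<close> is a unit, then \<open>a\<close> is a power of \<open>t a t\<^sup>-\<^sup>1\<close>. The groups \<open>t\<^sup>j\<langle>a\<rangle>t\<^bsup>-j\<^esup>\<close> therefore form an increasing chain,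
  and its union is an abelian normal subgroup that contains all conjugates of \<open>a\<close>.
\<close>

lemma conj_commute_unit:
  assumes n: "\<bar>n\<bar> = 1"
  shows "A i (act h (A i (finv (act h) w))) = act h (A i (finv (act h) (A i w)))"
proof -
  define U where "U = finv T"
  have TU [simp]: "(T ^^ j) ((U ^^ j) w) = w" "(U ^^ j) ((T ^^ j) w) = w" for j w
    by (simp_all add: U_def T_pow_inv_T_pow)
  have nn: "n * n = 1" using n by (metis abs_mult_self_eq mult_1)
  have up: "A i (T w) = T (A (m * n * i) w)" for i w
    using T_A_mult[of "n * i" w] nn by (simp add: mult.assoc[symmetric])
  have up_pow: "\<exists>i'. \<forall>w. A i ((T ^^ j) w) = (T ^^ j) (A i' w)" for i j
    by (induction j arbitrary: i) (use up in \<open>auto, metis\<close>)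
  have down_pow: "(U ^^ j) (A i w) = A i' ((U ^^ j) w)" if "\<And>w. A i ((T ^^ j) w) = (T ^^ j) (A i' w)" for i i' j w
    using that[of "(U ^^ j) w"] by simp
  have "\<exists>j k. \<forall>w. act h (A i (act (winv h) w)) = (T ^^ j) (A k ((U ^^ j) w))"
  proof (induction h)
    case Nil
    show ?case by (rule exI[of _ 0]) auto
  next
    case (Cons c h)
    then obtain j k where jk: "\<And>w. act h (A i (act (winv h) w)) = (T ^^ j) (A k ((U ^^ j) w))" by blast
    obtain x e where c: "c = (x, e)" by fastforce
    show ?case
    proof (cases x)
      case a
      define l where "l = (if e then 1 else - 1 :: int)"
      obtain l' where l': "\<And>w. A l ((T ^^ j) w) = (T ^^ j) (A l' w)" using up_pow by blast
      have "(U ^^ j) (A (- l) w) = A (- l') ((U ^^ j) w)" for w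
        using down_pow[OF l', of "A (- l) w"] by (metis A_neg_A)
      then have "act (c # h) (A i (act (winv (c # h)) w)) = (T ^^ j) (A k ((U ^^ j) w))" for w
        using jk l' A_comm[of l' k] by (auto simp: c a winv_Cons word_act_append l_def split: if_splits)
      then show ?thesis by blast
    next
      case t
      show ?thesis
      proof (cases e)
        case True
        have "act (c # h) (A i (act (winv (c # h)) w)) = (T ^^ Suc j) (A k ((U ^^ Suc j) w))" for w
          using jk by (simp add: c t True winv_Cons word_act_append t_act_def U_def funpow_swap1)
        then show ?thesis by blast
      next
        case False
        have *: "act (c # h) (A i (act (winv (c # h)) w)) = U ((T ^^ j) (A k ((U ^^ j) (T w))))" for w
          using jk by (simp add: c t False winv_Cons word_act_append t_act_def U_def)
        show ?thesis
        proof (cases j)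
          case 0
          then have "act (c # h) (A i (act (winv (c # h)) w)) = (T ^^ 0) (A (m * n * k) ((U ^^ 0) w))" for w
            unfolding * by (simp add: up U_def)
          then show ?thesis by blast
        next
          case (Suc j')
          have "(U ^^ j) (T w) = (U ^^ j') w" for w
            by (simp add: Suc U_def funpow_Suc_right del: funpow.simps)
          moreover have "U ((T ^^ j) w) = (T ^^ j') w" for w by (simp add: Suc U_def)
          ultimately show ?thesis unfolding * by auto
        qed
      qed
    qed
  qed
  then obtain j k where jk: "\<And>w. act h (A i (act (winv h) w)) = (T ^^ j) (A k ((U ^^ j) w))" by blast
  obtain i' where i': "\<And>w. A i ((T ^^ j) w) = (T ^^ j) (A i' w)" using up_pow by blast
  show ?thesis unfolding finv_act jk using i' down_pow[OF i'] A_comm[of i' k] by simp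
qed

end

lemma (in pingpong) conj_commute:
  assumes "\<bar>m\<bar> = 1 \<or> \<bar>n\<bar> = 1"
  shows "A i (act h (A i (finv (act h) w))) = act h (A i (finv (act h) (A i w)))"
proof (cases "\<bar>n\<bar> = 1")
  case True
  then show ?thesis by (rule conj_commute_unit)
next
  case False
  interpret D: pingpong A "finv T" n m Ym Yp B by (rule dual)
  have "word_act A (finv T) (flip_t h) = act h" by (simp add: act_flip_t flip_t_flip_t)
  then show ?thesis using D.conj_commute_unit[of i "flip_t h" w] assms False by simp
qed

text \<open>
  In the affine action \<open>h\<close> acts with slope \<open>(n/m)\<^sup>e\<close>, and conjugation multiplies translations by the slope.
\<close>

lemma modulus:
  assumes "m \<noteq> 0" "n \<noteq> 0" and eq: "bs_eq m n (h @ apow i) (apow j @ h)"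
  shows "\<exists>e. of_int j = (of_int n / of_int m :: rat) powi e * of_int i"
proof -
  define c :: rat where "c = of_int n / of_int m"
  have c: "c \<noteq> 0" using assms by (simp add: c_def)
  define T where "T = (\<lambda>q. c * q)"
  interpret bs_action "\<lambda>k q. q + of_int k" T m n
    by unfold_locales (use c in \<open>auto simp: T_def c_def field_simps intro!: bij_betwI[where g = "\<lambda>q. q / c"]\<close>)
  have inv: "finv T = (\<lambda>q. q / c)"
    by (rule inv_equality) (use c in \<open>auto simp: T_def\<close>)
  have "\<exists>e b. \<forall>q. act h q = c powi e * q + b"
  proof (induction h)
    case Nil
    show ?case by (rule exI[of _ 0]) auto
  next
    case (Cons l h)
    then obtain e b where eb: "\<And>q. act h q = c powi e * q + b" by blast
    obtain x f where l: "l = (x, f)" by fastforce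
    show ?case
    proof (cases x)
      case a
      have "act (l # h) q = c powi e * q + (b + of_int (if f then 1 else - 1))" for q
        by (simp add: l a eb)
      then show ?thesis by blast
    next
      case t
      have "act (l # h) q = (if f then c * act h q else act h q / c)" for q
        by (simp add: l t t_act_def inv) (simp add: T_def)
      then have "act (l # h) q = c powi (e + (if f then 1 else - 1)) * q + (if f then c * b else b / c)" for q
        unfolding eb using c by (simp add: power_int_add field_simps)
      then show ?thesis by blast
    qed
  qed
  then obtain e b where eb: "\<And>q. act h q = c powi e * q + b" by blast
  have "act (h @ apow i) 0 = act (apow j @ h) 0" using act_cong[OF eq] by simp
  then have "of_int j = c powi e * of_int i" by (simp add: word_act_append eb)
  then show ?thesis unfolding c_def by blast
qed

lemma (in bs_action) act_subst_conj:
  assumes x: "act (winv u @ x @ u) = A k"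
  shows "act (subst (apow k) (winv u @ y @ u) w) = act (winv u @ subst x y w @ u)"
proof -
  have x': "A k v = act (winv u) (act x (act u v))" for v
    using fun_cong[OF x, of v] by (simp add: word_act_append)
  have nx': "A (- k) v = act (winv u) (act (winv x) (act u v))" for v
  proof -
    have "A k (act (winv u) (act (winv x) (act u v))) = v" by (simp add: x')
    then show ?thesis by (metis A_neg_A(1))
  qed
  show ?thesis
  proof (induction w)
    case Nil
    show ?case by (auto simp: word_act_append)
  next
    case (Cons c w)
    show ?case
      by (cases c; cases "fst c") (auto simp: word_act_append Cons x' nx' fun_eq_iff)
  qed
qed

text \<open>
  The alternative in \<open>elliptic_or_commuting\<close> transfers to \<open>BS(r,s)\<close>, where it is refuted by ping-pong; so
  \<open>x\<close> is conjugate to a power of \<open>a\<close>, and the embedding can be conjugated.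
\<close>

lemma (in pingpong) embedding_with_apow:
  assumes nz: "r \<noteq> 0" "s \<noteq> 0" and rs: "\<not> (\<bar>r\<bar> = 1 \<and> \<bar>s\<bar> = 1)"
    and inj: "\<And>w. bs_eq r s w [] \<longleftrightarrow> bs_eq m n (subst x y w) []"
  shows "\<exists>k y. k \<noteq> 0 \<and> (\<forall>w. bs_eq r s w [] \<longleftrightarrow> bs_eq m n (subst (apow k) y w) [])"
proof -
  obtain T' :: "bs_point \<Rightarrow> bs_point" and Yp' Ym' B' where "pingpong shift T' r s Yp' Ym' B'"
    using pingpong_exists nz by blast
  then interpret H: pingpong shift T' r s Yp' Ym' B' .
  have transfer: "H.act u = H.act v \<longleftrightarrow> act (subst x y u) = act (subst x y v)" for u v
    unfolding H.act_eq_iff_bs_eq act_eq_iff_bs_eq by (rule subst_bs_eq_iff[OF inj])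
  have "act (y @ wpow x r) = act (wpow x s @ y)"
    using bs_eq_t_apow[of r s] unfolding subst_bs_eq_iff[OF inj] subst_tletter_apow by (rule act_cong)
  then have rel: "act y (act (wpow x r) w) = act (wpow x s) (act y w)" for w
    by (simp add: word_act_append fun_eq_iff)
  define w2 where "w2 a t = winv a @ t @ t @ a @ winv t @ winv t" for a t :: "bs_gen word"
  define w4 where "w4 a t = winv a @ t @ t @ t @ t @ a @ winv t @ winv t @ winv t @ winv t" for a t :: "bs_gen word"
  have "\<not> (\<bar>r\<bar> = \<bar>s\<bar> \<and> act (w2 x y @ w4 x y) = act (w4 x y @ w2 x y))"
  proof
    assume *: "\<bar>r\<bar> = \<bar>s\<bar> \<and> act (w2 x y @ w4 x y) = act (w4 x y @ w2 x y)"
    then have "\<not> r dvd 1" "\<not> s dvd 1" using rs by (auto simp: zdvd1_eq)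
    from H.conjugate_quotients_not_commute[OF this] * show False
      unfolding transfer by (simp add: subst_append subst_winv w2_def w4_def)
  qed
  then obtain u k where uk: "act (winv u @ x @ u) = A k"
    using elliptic_or_commuting[OF rel nz] unfolding w2_def w4_def by blast
  have subst: "bs_eq m n (subst (apow k) (winv u @ y @ u) w) [] \<longleftrightarrow> bs_eq m n (subst x y w) []" for w
  proof -
    have "act (winv u @ subst x y w @ u) = id \<longleftrightarrow> act (subst x y w) = id"
      by (auto simp: word_act_append fun_eq_iff) (metis act_act_winv)
    then show ?thesis
      using act_subst_conj[OF uk, of y w] by (simp flip: act_eq_iff_bs_eq)
  qed
  have "k \<noteq> 0"
  proof
    assume "k = 0"
    then have "bs_eq m n (subst (apow k) (winv u @ y @ u) (apow 1)) []"
      by (simp add: subst_apow wpow_def)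
    then have "bs_eq r s (apow 1) []" unfolding subst inj .
    then have "shift 1 w = w" for w :: bs_point using H.act_cong[of "apow 1" "[]"] by simp
    then show False using H.A_free by fastforce
  qed
  then show ?thesis using subst inj by blast
qed

text \<open>
  A relation \<open>x\<^sup>i y = y x\<^sup>j\<close> between \<open>x = a\<^sup>k\<close> and \<open>y\<close> can be read in both groups: in \<open>BS(r,s)\<close> it forces \<open>s dvd i\<close> and
  \<open>r dvd j\<close>, and in \<open>BS(m,n)\<close> it is supplied by \<open>prime_power_conj\<close> with exponents that contain few factors \<open>p\<close>. This gives the
  second condition.
\<close>

lemma (in pingpong) conditions_if_embeds:
  assumes nz: "m \<noteq> 0" "n \<noteq> 0" "r \<noteq> 0" "s \<noteq> 0" and rs: "\<not> (\<bar>r\<bar> = 1 \<and> \<bar>s\<bar> = 1)"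
    and emb: "embeds_in (BS r s) (BS m n)"
  shows "\<exists>k::int. (of_int r / of_int s :: rat) = (of_int m / of_int n) powi k"
    and "same_part_condition m n r s"
    and "\<bar>m\<bar> = 1 \<or> \<bar>n\<bar> = 1 \<Longrightarrow> \<bar>r\<bar> = 1 \<or> \<bar>s\<bar> = 1"
proof -
  obtain T' :: "bs_point \<Rightarrow> bs_point" and Yp' Ym' B' where "pingpong shift T' r s Yp' Ym' B'"
    using pingpong_exists nz by blast
  then interpret H: pingpong shift T' r s Yp' Ym' B' .
  obtain k y where k: "k \<noteq> 0" and inj: "\<And>w. bs_eq r s w [] \<longleftrightarrow> bs_eq m n (subst (apow k) y w) []"
    using emb embedding_with_apow[OF nz(3,4) rs] unfolding embeds_iff_subst by blast
  have transfer: "H.act u = H.act v \<longleftrightarrow> act (subst (apow k) y u) = act (subst (apow k) y v)" for u v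
    unfolding H.act_eq_iff_bs_eq act_eq_iff_bs_eq by (rule subst_bs_eq_iff[OF inj])
  have rel: "(\<forall>w. shift i (T' w) = T' (shift j w)) \<longleftrightarrow> (\<forall>w. A (k * i) (act y w) = act y (A (k * j) w))" for i j
    using transfer[of "apow i @ tletter True" "tletter True @ apow j"] unfolding subst_tletter_apow
    by (simp add: word_act_append act_wpow_apow fun_eq_iff H.t_act_def)
  show "\<exists>k::int. (of_int r / of_int s :: rat) = (of_int m / of_int n) powi k"
  proof -
    have "\<forall>w. A (k * s) (act y w) = act y (A (k * r) w)" using H.T_A by (simp flip: rel)
    then have "act (y @ apow (k * r)) = act (apow (k * s) @ y)" by (simp add: word_act_append fun_eq_iff)
    then obtain e where "of_int (k * s) = (of_int n / of_int m :: rat) powi e * of_int (k * r)"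
      using modulus[OF nz(1,2)] act_eq_iff_bs_eq by blast
    then have "(of_int s :: rat) = (of_int n / of_int m) powi e * of_int r" using k by simp
    then have "(of_int r / of_int s :: rat) = inverse ((of_int n / of_int m) powi e)"
      using nz by (simp add: field_simps)
    also have "\<dots> = (of_int m / of_int n) powi e" by (simp add: power_int_inverse[symmetric])
    finally show ?thesis by blast
  qed
  show "same_part_condition m n r s"
  proof (intro allI impI)
    fix p :: int and \<alpha> :: nat
    assume p: "Factorial_Ring.prime p"
      and dvds: "p ^ \<alpha> dvd m \<and> p ^ \<alpha> dvd n \<and> \<not> p ^ (\<alpha> + 1) dvd m \<and> \<not> p ^ (\<alpha> + 1) dvd n"
    obtain m1 n1 where mn: "m = p ^ \<alpha> * m1" "n = p ^ \<alpha> * n1" using dvds by (auto simp: dvd_def)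
    have "\<not> p dvd m1" "\<not> p dvd n1" using dvds p by (auto simp: mn)
    then obtain u v where uv: "\<not> p dvd u" "\<not> p dvd v"
      "\<And>j w. A (p ^ \<alpha> * u * j) (act y w) = act y (A (p ^ \<alpha> * v * j) w)"
      using prime_power_conj[OF p mn] by blast
    define \<beta> where "\<beta> = multiplicity p k"
    obtain k1 where k1: "k = p ^ \<beta> * k1" unfolding \<beta>_def using multiplicity_decompose'[of k p] k p
      by (metis not_prime_unit)
    \<comment> \<open>Truncated subtraction: if \<open>p\<close> divides \<open>k\<close> more than \<open>\<alpha>\<close> times, the relation between powers of \<open>a\<close> is first
      raised to the power \<open>p ^ (\<beta> - \<alpha>)\<close>, and \<open>\<gamma> = 0\<close>.\<close>
    define \<gamma> where "\<gamma> = \<alpha> - \<beta>"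
    have pp: "p ^ \<alpha> * p ^ (\<beta> - \<alpha>) = p ^ \<beta> * p ^ \<gamma>"
      unfolding \<gamma>_def by (cases "\<alpha> \<le> \<beta>") (simp_all flip: power_add)
    have mult: "p ^ \<alpha> * l * (p ^ (\<beta> - \<alpha>) * k1) = k * (p ^ \<gamma> * l)" for l
    proof -
      have "p ^ \<alpha> * l * (p ^ (\<beta> - \<alpha>) * k1) = (p ^ \<alpha> * p ^ (\<beta> - \<alpha>)) * (l * k1)" by (simp only: mult_ac)
      also have "\<dots> = k * (p ^ \<gamma> * l)" unfolding pp k1 by (simp only: mult_ac)
      finally show ?thesis .
    qed
    have "\<forall>w. A (k * (p ^ \<gamma> * u)) (act y w) = act y (A (k * (p ^ \<gamma> * v)) w)"
      using uv(3)[of "p ^ (\<beta> - \<alpha>) * k1"] unfolding mult by blast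
    then have "\<forall>w. shift (p ^ \<gamma> * u) (T' w) = T' (shift (p ^ \<gamma> * v) w)" unfolding rel .
    then have "s dvd p ^ \<gamma> * u" "r dvd p ^ \<gamma> * v"
      using H.edge_powers_if_commute[OF nz(3)] by blast+
    moreover have "\<not> p ^ (\<alpha> + 1) dvd p ^ \<gamma> * l" if "\<not> p dvd l" for l
    proof
      assume *: "p ^ (\<alpha> + 1) dvd p ^ \<gamma> * l"
      have "p ^ \<gamma> * p dvd p ^ (\<alpha> + 1)" unfolding \<gamma>_def power_Suc2[symmetric] by (rule le_imp_power_dvd) simp
      then have "p ^ \<gamma> * p dvd p ^ \<gamma> * l" using * by (rule dvd_trans)
      then show False using that p by auto
    qed
    ultimately show "\<not> p ^ (\<alpha> + 1) dvd r \<and> \<not> p ^ (\<alpha> + 1) dvd s" using uv(1,2) dvd_trans by blast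
  qed
  show "\<bar>r\<bar> = 1 \<or> \<bar>s\<bar> = 1" if "\<bar>m\<bar> = 1 \<or> \<bar>n\<bar> = 1"
  proof (rule ccontr)
    assume "\<not> (\<bar>r\<bar> = 1 \<or> \<bar>s\<bar> = 1)"
    then have "\<not> r dvd 1" "\<not> s dvd 1" by (auto simp: zdvd1_eq)
    then obtain w where "shift 1 (T' (shift 1 (finv T' w))) \<noteq> T' (shift 1 (finv T' (shift 1 w)))"
      using H.conjugate_not_commute by blast
    then have "H.act (apow 1 @ tletter True @ apow 1 @ tletter False) w \<noteq>
        H.act (tletter True @ apow 1 @ tletter False @ apow 1) w"
      by (simp add: word_act_append H.t_act_def)
    then have "H.act (apow 1 @ tletter True @ apow 1 @ tletter False) \<noteq>
        H.act (tletter True @ apow 1 @ tletter False @ apow 1)" by metis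
    then show False
      unfolding transfer using conj_commute[OF that, of k y]
      by (simp add: subst_append subst_apow act_wpow_apow word_act_append fun_eq_iff finv_act)
  qed
qed

section \<open>The classification\<close>

theorem theorem1p3:
  fixes m n r s :: int
  assumes "m \<noteq> 0" "n \<noteq> 0" "r \<noteq> 0" "s \<noteq> 0"
    and "\<not> (\<bar>r\<bar> = 1 \<and> \<bar>s\<bar> = 1)"
  shows "embeds_in (BS r s) (BS m n) \<longleftrightarrow>
     (\<exists>k::int. (of_int r / of_int s :: rat) = (of_int m / of_int n) powi k) \<and>
     (\<forall>(p::int) (\<alpha>::nat). Factorial_Ring.prime p \<longrightarrow>
        p ^ \<alpha> dvd m \<and> p ^ \<alpha> dvd n \<and> \<not> p ^ (\<alpha> + 1) dvd m \<and> \<not> p ^ (\<alpha> + 1) dvd n \<longrightarrow>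
        \<not> p ^ (\<alpha> + 1) dvd r \<and> \<not> p ^ (\<alpha> + 1) dvd s) \<and>
     (m \<in> {1, -1} \<or> n \<in> {1, -1} \<longrightarrow> r \<in> {1, -1} \<or> s \<in> {1, -1})"
proof -
  obtain T :: "bs_point \<Rightarrow> bs_point" and Yp Ym B where "pingpong shift T m n Yp Ym B"
    using pingpong_exists assms(1,2) by blast
  then interpret pingpong shift T m n Yp Ym B .
  have unit: "x \<in> {1, -1} \<longleftrightarrow> \<bar>x\<bar> = 1" for x :: int by auto
  show ?thesis
    unfolding unit using conditions_if_embeds[OF assms] embeds_if_conditions[OF assms] by blast
qed

end
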